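(* Let $h_0>0$ satisfy $$\frac{(T_0-T_{0l})k_l}{(T_{0l}-T_\infty)\sqrt{\pi \alpha_l}}<h_0<\frac{(T_0-T_{0s})k_l}{(T_{0s}-T_\infty)\sqrt{\pi \alpha_l}}.$$ Then the free boundary problem $(P_2)$ (stated in the context) has a unique solution of similarity type. It is given by $$\widehat s(t)=2\delta\sqrt{\alpha_s t},\quad t>0,$$ $$\widehat T_s(x,t)=\widehat T_k+\frac{h_0\sqrt{\pi\alpha_s}\,(\widehat T_k-T_\infty)}{k_s+h_0\sqrt{\pi\alpha_s}\,\mathrm{erf}(\delta)}\Big(\mathrm{erf}\Big(\frac{x}{2\sqrt{\alpha_s t}}\Big)-\mathrm{erf}(\delta)\Big),\quad 0<x<\widehat s(t),\ t>0,$$ $$\widehat T_l(x,t)=T_0+\frac{\widehat T_k-T_0}{\mathrm{erfc}\big(\sqrt{\alpha_s/\alpha_l}\,\delta\big)}\,\mathrm{erfc}\Big(\frac{x}{2\sqrt{\alpha_l t}}\Big),\quad x>\widehat s(t),\ t>0,$$ $$\widehat C_s(x,t)=f_s(\widehat T_k),\quad 0<x<\widehat s(t),\ t>0,$$ $$\widehat C_l(x,t)=C_0+\frac{f_l(\widehat T_k)-C_0}{\mathrm{erfc}\big(\sqrt{\alpha_s/d_l}\,\delta\big)}\,\mathrm{erfc}\Big(\frac{x}{2\sqrt{d_l t}}\Big),\quad x>\widehat s(t),\ t>0,$$ where the unknowns $\widehat T_k$ and $\delta$ satisfy $$\widehat T_k=W(\delta),\quad M(\delta)=\phi(\widehat T_k),\quad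 \delta>0,\quad T_A<\widehat T_k<T_B,$$ with $W$, $M$, $\phi$ the functions defined in the context.
   Context: Data. $\alpha_s,\alpha_l,d_s,d_l,k_s,k_l,\rho,\gamma$ are positive constants (subscripts $s$, $l$: solid, liquid). $T_A<T_B$ are real numbers, and $f_l,f_s:[T_A,T_B]\to\mathbb R$ are continuous strictly increasing functions (liquidus and solidus curves) with $$f_l(T_A)=f_s(T_A)<f_l(T)<f_s(T)<f_l(T_B)=f_s(T_B),\quad T_A<T<T_B.$$ $C_0$ is a constant with $f_l(T_A)<C_0<f_l(T_B)$, and $T_{0l}=f_l^{-1}(C_0)$, $T_{0s}=f_s^{-1}(C_0)$. $T_0$ is a constant with $T_A<T_0<T_B$. The alloy is initially liquid, i.e. $C_0<f_l(T_0)$. $T_\infty$ is a real constant (the bulk temperature), such that the two bounds on $h_0$ are defined. Problem $(P_2)$. Find a free boundary $s(t)>0$ ($t>0$), a constant $T_k\in(T_A,T_B)$, functions $T_s,C_s$ on $0<x<s(t)$, $t>0$, and functions $T_l,C_l$ on $x>s(t)$, $t>0$, such that, for all $t>0$ (initial and boundary values being understood as limits): (i) $\alpha_s T_{s,xx}=T_{s,t}$ for $0<x<s(t)$; (ii) $\alpha_l T_{l,xx}=T_{l,t}$ for $x>s(t)$; (iii) $d_s C_{s,xx}=C_{s,t}$ for $0<x<s(t)$; (iv) $d_l C_{l,xx}=C_{l,t}$ for $x>s(t)$; (v) $k_s T_{s,x}(0,t)=\frac{h_0}{\sqrt t}\big(T_s(0,t)-T_\infty\big)$; (vi) $T_s(s(t),t)=T_l(s(t),t)=T_k$;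 (vii) $T_l(x,0)=T_0$ for $x>0$; (viii) $T_l(\infty,t)=T_0$; (ix) $C_{s,x}(0,t)=0$; (x) $C_s(s(t),t)=f_s(T_k)$; (xi) $C_l(x,0)=C_0$ for $x>0$; (xii) $C_l(s(t),t)=f_l(T_k)$; (xiii) $k_sT_{s,x}(s(t),t)-k_lT_{l,x}(s(t),t)=\gamma\rho s'(t)$; (xiv) $d_lC_{l,x}(s(t),t)-d_sC_{s,x}(s(t),t)=[f_s(T_k)-f_l(T_k)]s'(t)$. A solution is of similarity type if each of $T_s,T_l,C_s,C_l$ has the form $A+B\,\mathrm{erf}\big(x/(2\sqrt{\kappa t})\big)$ with real constants $A,B$ (depending on the function), where $\kappa=\alpha_s,\alpha_l,d_s,d_l$ respectively. The solution is denoted with hats: $\widehat s,\widehat T_k,\widehat T_s,\widehat T_l,\widehat C_s,\widehat C_l$. Functions. $\mathrm{erf}(x)=\frac{2}{\sqrt\pi}\int_0^x e^{-t^2}dt$, $\mathrm{erfc}=1-\mathrm{erf}$, and for $x>0$ $$Q(x)=\sqrt{\pi}\,x e^{x^2}\mathrm{erfc}(x),\quad F_1(x)=e^{x^2}\mathrm{erfc}(x),\quad M(x)=\Big[Q\big(\sqrt{\alpha_s/d_l}\,x\big)\Big]^{-1},$$ $$F_2(x)=\frac{h_0k_s\sqrt{\pi\alpha_l}\,e^{-x^2}F_1\big(\sqrt{\alpha_s/\alpha_l}\,x\big)}{k_l\big(k_s+h_0\sqrt{\pi\alpha_s}\,\mathrm{erf}(x)\big)},$$ $$H(x)=\frac{h_0k_s\sqrt{\pi\alpha_l}}{xe^{x^2}\big(k_s+h_0\sqrt{\pi\alpha_s}\,\mathrm{erf}(x)\big)}+\frac{k_l\sqrt{\pi\alpha_s}}{\sqrt{\alpha_l}\,Q\big(\sqrt{\alpha_s/\alpha_l}\,x\big)},$$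 $$W(x)=T_\infty+\frac{T_0-T_\infty}{F_2(x)+1}+\frac{\gamma\rho\sqrt{\pi\alpha_s\alpha_l}}{H(x)},$$ $$\phi(x)=\frac{f_s(x)-f_l(x)}{C_0-f_l(x)},\quad x\in(T_A,T_{0l})\cup(T_{0l},T_B).$$ *)

theory Defs
  imports "HOL-Analysis.Analysis"
begin

(* The oriented interval integral makes erf odd, so the definition is correct for x < 0 too. *)
definition erf :: "real \<Rightarrow> real" where
  "erf x = 2 / sqrt pi * (LBINT t=0..x. exp (- t\<^sup>2))"

definition erfc :: "real \<Rightarrow> real" where
  "erfc x = 1 - erf x"

definition Q :: "real \<Rightarrow> real" where
  "Q x = sqrt pi * x * exp (x\<^sup>2) * erfc x"

definition F\<^sub>1 :: "real \<Rightarrow> real" where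
  "F\<^sub>1 x = exp (x\<^sup>2) * erfc x"

(* Subscripts s and l stand for solid and liquid; f\<^sub>l is the liquidus and f\<^sub>s the solidus curve,
   of which only the values on the interval from T\<^sub>A to T\<^sub>B matter. T_inf is the bulk temperature. *)
record alloy_data =
  \<alpha>\<^sub>s :: real
  \<alpha>\<^sub>l :: real
  d\<^sub>s :: real
  d\<^sub>l :: real
  k\<^sub>s :: real
  k\<^sub>l :: real
  \<rho> :: real
  \<gamma> :: real
  T\<^sub>A :: real
  T\<^sub>B :: real
  f\<^sub>l :: "real \<Rightarrow> real"
  f\<^sub>s :: "real \<Rightarrow> real"
  C\<^sub>0 :: real
  T\<^sub>0 :: real
  T_inf :: real

definition T\<^sub>0\<^sub>l :: "alloy_data \<Rightarrow> real" where
  "T\<^sub>0\<^sub>l D = the_inv_into {T\<^sub>A D..T\<^sub>B D} (f\<^sub>l D) (C\<^sub>0 D)"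

definition T\<^sub>0\<^sub>s :: "alloy_data \<Rightarrow> real" where
  "T\<^sub>0\<^sub>s D = the_inv_into {T\<^sub>A D..T\<^sub>B D} (f\<^sub>s D) (C\<^sub>0 D)"

(* The last two assumptions say that the bounds imposed on h0 have nonzero denominators. *)
locale alloy =
  fixes D :: alloy_data
  assumes pos: "\<alpha>\<^sub>s D > 0" "\<alpha>\<^sub>l D > 0" "d\<^sub>s D > 0" "d\<^sub>l D > 0" "k\<^sub>s D > 0" "k\<^sub>l D > 0"
      "\<rho> D > 0" "\<gamma> D > 0"
    and T_A_less_T_B: "T\<^sub>A D < T\<^sub>B D"
    and cont_f_l: "continuous_on {T\<^sub>A D..T\<^sub>B D} (f\<^sub>l D)"
    and cont_f_s: "continuous_on {T\<^sub>A D..T\<^sub>B D} (f\<^sub>s D)"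
    and mono_f_l: "strict_mono_on {T\<^sub>A D..T\<^sub>B D} (f\<^sub>l D)"
    and mono_f_s: "strict_mono_on {T\<^sub>A D..T\<^sub>B D} (f\<^sub>s D)"
    and curves_A: "f\<^sub>l D (T\<^sub>A D) = f\<^sub>s D (T\<^sub>A D)"
    and curves_B: "f\<^sub>l D (T\<^sub>B D) = f\<^sub>s D (T\<^sub>B D)"
    and curves_between: "\<And>T. T\<^sub>A D < T \<Longrightarrow> T < T\<^sub>B D \<Longrightarrow>
      f\<^sub>s D (T\<^sub>A D) < f\<^sub>l D T \<and> f\<^sub>l D T < f\<^sub>s D T \<and> f\<^sub>s D T < f\<^sub>l D (T\<^sub>B D)"
    and C_0: "f\<^sub>l D (T\<^sub>A D) < C\<^sub>0 D" "C\<^sub>0 D < f\<^sub>l D (T\<^sub>B D)"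
    and T_0: "T\<^sub>A D < T\<^sub>0 D" "T\<^sub>0 D < T\<^sub>B D"
    and initially_liquid: "C\<^sub>0 D < f\<^sub>l D (T\<^sub>0 D)"
    and T_inf_l: "T_inf D \<noteq> T\<^sub>0\<^sub>l D"
    and T_inf_s: "T_inf D \<noteq> T\<^sub>0\<^sub>s D"

definition M :: "alloy_data \<Rightarrow> real \<Rightarrow> real" where
  "M D x = inverse (Q (sqrt (\<alpha>\<^sub>s D / d\<^sub>l D) * x))"

definition F\<^sub>2 :: "alloy_data \<Rightarrow> real \<Rightarrow> real \<Rightarrow> real" where
  "F\<^sub>2 D h0 x =
     h0 * k\<^sub>s D * sqrt (pi * \<alpha>\<^sub>l D) * exp (- x\<^sup>2) * F\<^sub>1 (sqrt (\<alpha>\<^sub>s D / \<alpha>\<^sub>l D) * x) /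
     (k\<^sub>l D * (k\<^sub>s D + h0 * sqrt (pi * \<alpha>\<^sub>s D) * erf x))"

definition H :: "alloy_data \<Rightarrow> real \<Rightarrow> real \<Rightarrow> real" where
  "H D h0 x =
     h0 * k\<^sub>s D * sqrt (pi * \<alpha>\<^sub>l D) /
       (x * exp (x\<^sup>2) * (k\<^sub>s D + h0 * sqrt (pi * \<alpha>\<^sub>s D) * erf x)) +
     k\<^sub>l D * sqrt (pi * \<alpha>\<^sub>s D) / (sqrt (\<alpha>\<^sub>l D) * Q (sqrt (\<alpha>\<^sub>s D / \<alpha>\<^sub>l D) * x))"

definition W :: "alloy_data \<Rightarrow> real \<Rightarrow> real \<Rightarrow> real" where
  "W D h0 x =
     T_inf D + (T\<^sub>0 D - T_inf D) / (F\<^sub>2 D h0 x + 1) +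
     \<gamma> D * \<rho> D * sqrt (pi * \<alpha>\<^sub>s D * \<alpha>\<^sub>l D) / H D h0 x"

definition \<phi> :: "alloy_data \<Rightarrow> real \<Rightarrow> real" where
  "\<phi> D x = (f\<^sub>s D x - f\<^sub>l D x) / (C\<^sub>0 D - f\<^sub>l D x)"

(* The conditions T\<^sub>A D < T < T\<^sub>B D and T \<noteq> T\<^sub>0\<^sub>l D make up the domain of \<phi>. *)
definition coupled_system :: "alloy_data \<Rightarrow> real \<Rightarrow> real \<Rightarrow> real \<Rightarrow> bool" where
  "coupled_system D h0 \<delta> T \<longleftrightarrow>
     \<delta> > 0 \<and> T\<^sub>A D < T \<and> T < T\<^sub>B D \<and> T \<noteq> T\<^sub>0\<^sub>l D \<and>
     T = W D h0 \<delta> \<and> M D \<delta> = \<phi> D T"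

definition solves_heat_at :: "real \<Rightarrow> (real \<Rightarrow> real \<Rightarrow> real) \<Rightarrow> real \<Rightarrow> real \<Rightarrow> bool" where
  "solves_heat_at \<kappa> u x t \<longleftrightarrow>
     (\<lambda>y. u y t) differentiable (at x) \<and>
     (\<lambda>y. deriv (\<lambda>z. u z t) y) differentiable (at x) \<and>
     (\<lambda>\<tau>. u x \<tau>) differentiable (at t) \<and>
     \<kappa> * deriv (\<lambda>y. deriv (\<lambda>z. u z t) y) x = deriv (\<lambda>\<tau>. u x \<tau>) t"

(* T\<^sub>s and C\<^sub>s (T\<^sub>l and C\<^sub>l) are total functions of x and t of which only the values at 0 < x < s t
   (at x > s t) with t > 0 are relevant. Boundary values of the unknowns and of their
   x-derivatives are limits from inside that region. The differentiability of s is implicit in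
   the occurrence of its derivative in the two interface conditions; it makes both regions open.
   The limit at an initial point (x, 0) is taken over those t at which (x, t) lies in the liquid. *)
definition solves_P2 ::
  "alloy_data \<Rightarrow> real \<Rightarrow> (real \<Rightarrow> real) \<Rightarrow> real \<Rightarrow>
   (real \<Rightarrow> real \<Rightarrow> real) \<Rightarrow> (real \<Rightarrow> real \<Rightarrow> real) \<Rightarrow>
   (real \<Rightarrow> real \<Rightarrow> real) \<Rightarrow> (real \<Rightarrow> real \<Rightarrow> real) \<Rightarrow> bool" where
  "solves_P2 D h0 s Tk Ts Tl Cs Cl \<longleftrightarrow>
     T\<^sub>A D < Tk \<and> Tk < T\<^sub>B D \<and>
     (\<forall>t>0. s t > 0 \<and> s differentiable (at t)) \<and>
     (\<forall>t>0. \<forall>x. 0 < x \<and> x < s t \<longrightarrow>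
        solves_heat_at (\<alpha>\<^sub>s D) Ts x t \<and> solves_heat_at (d\<^sub>s D) Cs x t) \<and>
     (\<forall>t>0. \<forall>x > s t. solves_heat_at (\<alpha>\<^sub>l D) Tl x t \<and> solves_heat_at (d\<^sub>l D) Cl x t) \<and>
     (\<forall>t>0. \<exists>v g. ((\<lambda>x. Ts x t) \<longlongrightarrow> v) (at_right 0) \<and>
        ((\<lambda>x. deriv (\<lambda>y. Ts y t) x) \<longlongrightarrow> g) (at_right 0) \<and>
        k\<^sub>s D * g = h0 / sqrt t * (v - T_inf D)) \<and>
     (\<forall>t>0. ((\<lambda>x. Ts x t) \<longlongrightarrow> Tk) (at_left (s t)) \<and> ((\<lambda>x. Tl x t) \<longlongrightarrow> Tk) (at_right (s t))) \<and>
     (\<forall>x>0. ((\<lambda>t. Tl x t) \<longlongrightarrow> T\<^sub>0 D) (at 0 within {t. 0 < t \<and> s t < x})) \<and>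
     (\<forall>t>0. ((\<lambda>x. Tl x t) \<longlongrightarrow> T\<^sub>0 D) at_top) \<and>
     (\<forall>t>0. ((\<lambda>x. deriv (\<lambda>y. Cs y t) x) \<longlongrightarrow> 0) (at_right 0)) \<and>
     (\<forall>t>0. ((\<lambda>x. Cs x t) \<longlongrightarrow> f\<^sub>s D Tk) (at_left (s t))) \<and>
     (\<forall>x>0. ((\<lambda>t. Cl x t) \<longlongrightarrow> C\<^sub>0 D) (at 0 within {t. 0 < t \<and> s t < x})) \<and>
     (\<forall>t>0. ((\<lambda>x. Cl x t) \<longlongrightarrow> f\<^sub>l D Tk) (at_right (s t))) \<and>
     (\<forall>t>0. \<exists>gs gl. ((\<lambda>x. deriv (\<lambda>y. Ts y t) x) \<longlongrightarrow> gs) (at_left (s t)) \<and>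
        ((\<lambda>x. deriv (\<lambda>y. Tl y t) x) \<longlongrightarrow> gl) (at_right (s t)) \<and>
        k\<^sub>s D * gs - k\<^sub>l D * gl = \<gamma> D * \<rho> D * deriv s t) \<and>
     (\<forall>t>0. \<exists>gs gl. ((\<lambda>x. deriv (\<lambda>y. Cs y t) x) \<longlongrightarrow> gs) (at_left (s t)) \<and>
        ((\<lambda>x. deriv (\<lambda>y. Cl y t) x) \<longlongrightarrow> gl) (at_right (s t)) \<and>
        d\<^sub>l D * gl - d\<^sub>s D * gs = (f\<^sub>s D Tk - f\<^sub>l D Tk) * deriv s t)"

definition similarity_form_on :: "(real \<times> real) set \<Rightarrow> real \<Rightarrow> (real \<Rightarrow> real \<Rightarrow> real) \<Rightarrow> bool" where
  "similarity_form_on R \<kappa> u \<longleftrightarrow>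
     (\<exists>A B. \<forall>(x, t) \<in> R. u x t = A + B * erf (x / (2 * sqrt (\<kappa> * t))))"

definition solid_region :: "(real \<Rightarrow> real) \<Rightarrow> (real \<times> real) set" where
  "solid_region s = {(x, t). 0 < t \<and> 0 < x \<and> x < s t}"

definition liquid_region :: "(real \<Rightarrow> real) \<Rightarrow> (real \<times> real) set" where
  "liquid_region s = {(x, t). 0 < t \<and> s t < x}"

definition similarity_solution ::
  "alloy_data \<Rightarrow> real \<Rightarrow> (real \<Rightarrow> real) \<Rightarrow> real \<Rightarrow>
   (real \<Rightarrow> real \<Rightarrow> real) \<Rightarrow> (real \<Rightarrow> real \<Rightarrow> real) \<Rightarrow>
   (real \<Rightarrow> real \<Rightarrow> real) \<Rightarrow> (real \<Rightarrow> real \<Rightarrow> real) \<Rightarrow> bool" where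
  "similarity_solution D h0 s Tk Ts Tl Cs Cl \<longleftrightarrow>
     solves_P2 D h0 s Tk Ts Tl Cs Cl \<and>
     similarity_form_on (solid_region s) (\<alpha>\<^sub>s D) Ts \<and>
     similarity_form_on (liquid_region s) (\<alpha>\<^sub>l D) Tl \<and>
     similarity_form_on (solid_region s) (d\<^sub>s D) Cs \<and>
     similarity_form_on (liquid_region s) (d\<^sub>l D) Cl"

end

theory Submission
  imports Defs "HOL-Probability.Distributions" "HOL-Real_Asymp.Real_Asymp"
begin

text \<open>
  A profile $A + B\,\mathrm{erf}(x / (2\sqrt{\kappa t}))$ takes the constant value $T_k$ along the
  front for all times only if the similarity variable is constant there or $B = 0$. The temperatures
  of the two phases cannot both be constant: by the convective condition a constant solid would have
  temperature $T_\infty$, a constant liquid has temperature $T_0$, they meet at the front, and the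
  bounds on $h_0$ force $T_\infty < T_0$. Hence $s(t) = 2\delta\sqrt{\alpha_s t}$ for some
  $\delta > 0$. The values at the front and the conditions at the wall, at infinity and at time zero
  then give all coefficients
  in terms of $\delta$ and $T_k$ (\<open>similarity_solution_determined\<close>), and the two
  conditions left, conservation of heat and of solute at the front, become $T_k = W(\delta)$ and
  $M(\delta) = \phi(T_k)$ (\<open>heat_balance_iff\<close>, \<open>solute_balance_iff\<close>).
  These are equivalences, so any solution of the coupled system conversely yields a
  solution of the free boundary problem (\<open>similarity_solution_of_coupled_system\<close>).

  The coupled system has exactly one solution for reasons of monotonicity. With
  $r = \sqrt{\alpha_s/\alpha_l}$ one has
  \<open>W x = T_inf + (T0 - T_inf + c * Q (r * x)) / (F2 x + 1)\<close>, where
  $c = \gamma\rho\alpha_l/k_l$ (\<open>W_eq\<close>). Since $Q$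
  increases and $F_2$ decreases, $W$ increases. The two bounds on $h_0$ say precisely that
  $T_{0s} < W(0) < T_{0l}$, and $W$ passes $T_{0l}$ because $F_2$ tends to zero while $T_{0l} < T_0$.
  Since $0 < Q < 1$, the function $M$ exceeds $1$ and decreases; $\phi(T) > 1$ holds only for $T$
  between $T_{0s}$ and $T_{0l}$, where $\phi$ increases. So $\phi \circ W$ increases and $M$
  decreases wherever they can agree, which leaves at most one solution
  (\<open>coupled_system_unique\<close>); it exists by the intermediate value theorem
  (\<open>coupled_system_exists\<close>).

  All the analytic input consists of two bounds for $\mathrm{erfc}$, that is, for Mills' ratio: the
  upper one gives $Q < 1$ and the decrease of $F_1$, the lower one the increase of $Q$.
\<close>

section \<open>The error function and Mills' ratio\<close>

lemma erf_0 [simp]: "erf 0 = 0"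
  by (simp add: erf_def zero_ereal_def[symmetric])

lemma erfc_0 [simp]: "erfc 0 = 1"
  by (simp add: erfc_def)

text \<open>The fundamental theorem of calculus, on an interval that contains both $0$ and $x$ in its interior.\<close>
lemma has_real_derivative_erf: "(erf has_real_derivative 2 / sqrt pi * exp (- x\<^sup>2)) (at x)"
proof -
  define a where "a = min 0 x - 1"
  define b where "b = max 0 x + 1"
  have "((\<lambda>u. LBINT t=ereal 0..u. exp (- t\<^sup>2)) has_vector_derivative exp (- x\<^sup>2)) (at x within {a..b})"
    by (rule interval_integral_FTC2) (auto simp: a_def b_def intro!: continuous_intros)
  moreover have "at x within {a..b} = at x"
    by (rule at_within_interior) (auto simp: a_def b_def)
  ultimately have "((\<lambda>u. LBINT t=0..u. exp (- t\<^sup>2)) has_real_derivative exp (- x\<^sup>2)) (at x)"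
    by (simp add: has_real_derivative_iff_has_vector_derivative zero_ereal_def)
  then show ?thesis
    unfolding erf_def[abs_def] by (rule DERIV_cmult)
qed

lemma DERIV_erf [derivative_intros]:
  "(g has_real_derivative g') (at x within S) \<Longrightarrow>
   ((\<lambda>x. erf (g x)) has_real_derivative 2 / sqrt pi * exp (- (g x)\<^sup>2) * g') (at x within S)"
  using DERIV_chain2[OF has_real_derivative_erf, of g g' x S] by simp

lemma DERIV_erfc [derivative_intros]:
  "(g has_real_derivative g') (at x within S) \<Longrightarrow>
   ((\<lambda>x. erfc (g x)) has_real_derivative - (2 / sqrt pi * exp (- (g x)\<^sup>2) * g')) (at x within S)"
  unfolding erfc_def by (auto intro!: derivative_eq_intros)

lemma isCont_erf: "isCont erf x"
  using has_real_derivative_erf by (rule DERIV_isCont)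

lemma tendsto_erf [tendsto_intros]: "(g \<longlongrightarrow> a) F \<Longrightarrow> ((\<lambda>x. erf (g x)) \<longlongrightarrow> erf a) F"
  using isCont_erf by (rule isCont_tendsto_compose)

lemma continuous_on_erf [continuous_intros]:
  "continuous_on S g \<Longrightarrow> continuous_on S (\<lambda>x. erf (g x))"
  by (auto simp: continuous_on_def intro!: tendsto_intros)

lemma continuous_on_erfc [continuous_intros]:
  "continuous_on S g \<Longrightarrow> continuous_on S (\<lambda>x. erfc (g x))"
  unfolding erfc_def by (intro continuous_intros)

lemma strict_mono_erf: "strict_mono erf"
proof
  fix x y :: real
  assume "x < y"
  then show "erf x < erf y"
    by (rule DERIV_pos_imp_increasing) (use has_real_derivative_erf in fastforce)
qed

lemma erf_less_iff [simp]: "erf x < erf y \<longleftrightarrow> x < y"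
  using strict_mono_less[OF strict_mono_erf] .

lemma erf_eq_iff [simp]: "erf x = erf y \<longleftrightarrow> x = y"
  using strict_mono_eq[OF strict_mono_erf] .

lemma erf_pos: "0 < x \<Longrightarrow> 0 < erf x"
  using erf_less_iff[of 0 x] by simp

text \<open>The normalisation of the error function is the Gaussian integral over the half-line.\<close>
lemma erf_at_top: "(erf \<longlongrightarrow> 1) at_top"
proof -
  let ?g = "\<lambda>t::real. indicator {0..} t *\<^sub>R exp (- t\<^sup>2)"
  have "((\<lambda>y. \<integral>t. indicator {..y} t *\<^sub>R ?g t \<partial>lborel) \<longlongrightarrow> (\<integral>t. ?g t \<partial>lborel)) at_top"
    using gaussian_moment_0
    by (intro tendsto_integral_at_top) (auto simp: has_bochner_integral_iff)
  then have "((\<lambda>y. 2 / sqrt pi * (\<integral>t. indicator {..y} t *\<^sub>R ?g t \<partial>lborel)) \<longlongrightarrow> 2 / sqrt pi * (sqrt pi / 2)) at_top"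
    by (intro tendsto_mult[OF tendsto_const])
      (simp only: has_bochner_integral_integral_eq[OF gaussian_moment_0])
  moreover have "\<forall>\<^sub>F y in at_top. 2 / sqrt pi * (\<integral>t. indicator {..y} t *\<^sub>R ?g t \<partial>lborel) = erf y"
    using eventually_ge_at_top[of 0]
  proof eventually_elim
    case (elim y)
    have "(LBINT t=ereal 0..ereal y. exp (- t\<^sup>2)) = (LBINT t:{0..y}. exp (- t\<^sup>2))"
      by (rule interval_integral_Icc[OF elim])
    also have "\<dots> = (\<integral>t. indicator {..y} t *\<^sub>R ?g t \<partial>lborel)"
      unfolding set_lebesgue_integral_def
      by (rule Bochner_Integration.integral_cong) (auto simp: indicator_def)
    finally show ?case
      by (simp add: erf_def zero_ereal_def)
  qed
  ultimately show ?thesis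
    by (auto intro: Lim_transform_eventually)
qed

lemma erfc_at_top: "(erfc \<longlongrightarrow> 0) at_top"
  unfolding erfc_def using tendsto_diff[OF tendsto_const erf_at_top, of 1] by simp

lemma erfc_pos [simp]: "0 < erfc x"
proof (rule DERIV_neg_imp_decreasing_at_top[OF _ erfc_at_top])
  fix y :: real
  have "(erfc has_real_derivative - (2 / sqrt pi * exp (- y\<^sup>2))) (at y)"
    using DERIV_erfc[OF DERIV_ident] by simp
  then show "\<exists>d. (erfc has_real_derivative d) (at y) \<and> d < 0"
    by fastforce
qed

lemma erfc_nonzero [simp]: "erfc x \<noteq> 0"
  using erfc_pos[of x] by linarith

lemma divide_erfc_mult_erf: "c / erfc y * erf y = c / erfc y - c"
proof -
  have "erf y = 1 - erfc y"
    by (simp add: erfc_def)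
  then show ?thesis
    by (simp add: right_diff_distrib)
qed

text \<open>The difference of the two sides, divided by $x$, has derivative $-e^{-x^2}/x^2 < 0$ and
  tends to zero at infinity, so it is positive.\<close>
lemma erfc_upper_bound:
  assumes "x > 0"
  shows "sqrt pi * x * erfc x < exp (- x\<^sup>2)"
proof -
  define g where "g = (\<lambda>y::real. exp (- y\<^sup>2) / y - sqrt pi * erfc y)"
  have "0 < g x"
  proof (rule DERIV_neg_imp_decreasing_at_top[where f = g and b = x])
    fix y assume "x \<le> y"
    with assms have y: "y > 0" by simp
    have "(g has_real_derivative - (exp (- y\<^sup>2) / y\<^sup>2)) (at y)"
      unfolding g_def using y
      by (auto intro!: derivative_eq_intros simp: field_simps power2_eq_square)
    moreover have "exp (- y\<^sup>2) / y\<^sup>2 > 0"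
      using y by simp
    ultimately show "\<exists>d. (g has_real_derivative d) (at y) \<and> d < 0"
      by force
  next
    have "((\<lambda>y::real. exp (- y\<^sup>2) / y) \<longlongrightarrow> 0) at_top"
      by real_asymp
    then show "(g \<longlongrightarrow> 0) at_top"
      unfolding g_def using tendsto_diff[OF _ tendsto_mult[OF tendsto_const erfc_at_top]] by force
  qed
  then show ?thesis
    using assms by (simp add: g_def field_simps)
qed

text \<open>Dividing by $1 + 2x^2$, the difference of the two sides has derivative
  $-4 e^{-x^2}/(1+2x^2)^2 < 0$ and tends to zero at infinity. This denominator is the right one for
  the monotonicity of $Q$, because $Q'(x) = \sqrt\pi\,(1+2x^2)\,e^{x^2}\mathrm{erfc}(x) - 2x$.\<close>
lemma erfc_lower_bound:
  "2 * x * exp (- x\<^sup>2) < sqrt pi * (1 + 2 * x\<^sup>2) * erfc x"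
proof -
  define g where "g = (\<lambda>y::real. sqrt pi * erfc y - 2 * y * exp (- y\<^sup>2) / (1 + 2 * y\<^sup>2))"
  have "0 < g x"
  proof (rule DERIV_neg_imp_decreasing_at_top[where f = g and b = x])
    fix y assume "x \<le> y"
    have nz: "1 + 2 * y\<^sup>2 > 0"
      by (simp add: add_pos_nonneg)
    have "(g has_real_derivative - (4 * exp (- y\<^sup>2) / (1 + 2 * y\<^sup>2)\<^sup>2)) (at y)"
      unfolding g_def using nz
      by (auto intro!: derivative_eq_intros simp: less_imp_neq[THEN not_sym],
          simp add: divide_simps, simp add: algebra_simps power2_eq_square)
    moreover have "4 * exp (- y\<^sup>2) / (1 + 2 * y\<^sup>2)\<^sup>2 > 0"
      using nz by simp
    ultimately show "\<exists>d. (g has_real_derivative d) (at y) \<and> d < 0"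
      by force
  next
    have "((\<lambda>y::real. 2 * y * exp (- y\<^sup>2) / (1 + 2 * y\<^sup>2)) \<longlongrightarrow> 0) at_top"
      by real_asymp
    then show "(g \<longlongrightarrow> 0) at_top"
      unfolding g_def using tendsto_diff[OF tendsto_mult[OF tendsto_const erfc_at_top]] by force
  qed
  moreover have "1 + 2 * x\<^sup>2 > 0"
    by (simp add: add_pos_nonneg)
  ultimately show ?thesis
    by (simp add: g_def field_simps)
qed

lemma F1_pos: "0 < F\<^sub>1 x"
  by (simp add: F\<^sub>1_def)

lemma Q_eq_F1: "Q x = sqrt pi * x * F\<^sub>1 x"
  by (simp add: Q_def F\<^sub>1_def)

lemma Q_pos: "0 < x \<Longrightarrow> 0 < Q x"
  by (simp add: Q_def)

lemma Q_less_1: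
  assumes "0 < x"
  shows "Q x < 1"
proof -
  have "exp (x\<^sup>2) * (sqrt pi * x * erfc x) < exp (x\<^sup>2) * exp (- x\<^sup>2)"
    using erfc_upper_bound[OF assms] by simp
  also have "\<dots> = 1"
    by (simp add: exp_minus)
  finally show ?thesis
    by (simp add: Q_def mult_ac)
qed

lemma continuous_on_F1 [continuous_intros]:
  "continuous_on S g \<Longrightarrow> continuous_on S (\<lambda>x. F\<^sub>1 (g x))"
  unfolding F\<^sub>1_def by (intro continuous_intros)

text \<open>The differential equation $F_1' = \frac{2}{\sqrt\pi}\,(Q - 1)$ turns the bound $Q < 1$ into
  monotonicity.\<close>
lemma F1_strict_antimono:
  assumes "0 \<le> x" "x < y"
  shows "F\<^sub>1 y < F\<^sub>1 x"
proof (rule DERIV_neg_imp_decreasing_open[OF assms(2)])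
  fix z assume "x < z" "z < y"
  with assms have z: "z > 0" by simp
  have "(F\<^sub>1 has_real_derivative 2 / sqrt pi * (Q z - 1)) (at z)"
    unfolding F\<^sub>1_def[abs_def]
    by (auto intro!: derivative_eq_intros simp: Q_def field_simps exp_minus)
  moreover have "2 / sqrt pi * (Q z - 1) < 0"
    using Q_less_1[OF z] by (simp add: divide_less_0_iff)
  ultimately show "\<exists>d. (F\<^sub>1 has_real_derivative d) (at z) \<and> d < 0"
    by blast
qed (intro continuous_intros)

lemma strict_mono_Q: "strict_mono Q"
proof
  fix x y :: real
  assume "x < y"
  then show "Q x < Q y"
  proof (rule DERIV_pos_imp_increasing)
    fix z
    have "(Q has_real_derivative sqrt pi * (1 + 2 * z\<^sup>2) * F\<^sub>1 z - 2 * z) (at z)"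
      unfolding Q_def[abs_def]
      by (auto intro!: derivative_eq_intros simp: F\<^sub>1_def field_simps exp_minus power2_eq_square)
    moreover have "2 * z < sqrt pi * (1 + 2 * z\<^sup>2) * F\<^sub>1 z"
    proof -
      have "exp (z\<^sup>2) * (2 * z * exp (- z\<^sup>2)) < exp (z\<^sup>2) * (sqrt pi * (1 + 2 * z\<^sup>2) * erfc z)"
        using erfc_lower_bound[of z] by simp
      then show ?thesis
        by (simp add: F\<^sub>1_def exp_minus field_simps)
    qed
    ultimately show "\<exists>d. (Q has_real_derivative d) (at z) \<and> 0 < d"
      by fastforce
  qed
qed

section \<open>The phase diagram\<close>

lemma the_inv_into_strict_mono_on:
  fixes f :: "real \<Rightarrow> real"
  assumes cont: "continuous_on {a..b} f" and mono: "strict_mono_on {a..b} f"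
    and le: "a \<le> b" and c: "f a < c" "c < f b"
  defines "x \<equiv> the_inv_into {a..b} f c"
  shows "a < x" "x < b" "f x = c"
proof -
  obtain y where y: "a \<le> y" "y \<le> b" "f y = c"
    using IVT'[of f a c b] cont le c by auto
  then have "x = y"
    using the_inv_into_f_f[OF strict_mono_on_imp_inj_on[OF mono], of y] by (simp add: x_def)
  with y c show "a < x" "x < b" "f x = c"
    by (auto simp: order.order_iff_strict)
qed

locale convective_alloy = alloy +
  fixes h0 :: real
  assumes h0_pos: "h0 > 0"
    and h0_lower: "(T\<^sub>0 D - T\<^sub>0\<^sub>l D) * k\<^sub>l D / ((T\<^sub>0\<^sub>l D - T_inf D) * sqrt (pi * \<alpha>\<^sub>l D)) < h0"
    and h0_upper: "h0 < (T\<^sub>0 D - T\<^sub>0\<^sub>s D) * k\<^sub>l D / ((T\<^sub>0\<^sub>s D - T_inf D) * sqrt (pi * \<alpha>\<^sub>l D))"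

context alloy
begin

lemma f_l_less_iff:
  "x \<in> {T\<^sub>A D..T\<^sub>B D} \<Longrightarrow> y \<in> {T\<^sub>A D..T\<^sub>B D} \<Longrightarrow> f\<^sub>l D x < f\<^sub>l D y \<longleftrightarrow> x < y"
  using strict_mono_on_less[OF mono_f_l] by blast

lemma f_s_less_iff:
  "x \<in> {T\<^sub>A D..T\<^sub>B D} \<Longrightarrow> y \<in> {T\<^sub>A D..T\<^sub>B D} \<Longrightarrow> f\<^sub>s D x < f\<^sub>s D y \<longleftrightarrow> x < y"
  using strict_mono_on_less[OF mono_f_s] by blast

lemma T0l: "T\<^sub>A D < T\<^sub>0\<^sub>l D" "T\<^sub>0\<^sub>l D < T\<^sub>B D" "f\<^sub>l D (T\<^sub>0\<^sub>l D) = C\<^sub>0 D"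
  unfolding T\<^sub>0\<^sub>l_def
  by (rule the_inv_into_strict_mono_on[OF cont_f_l mono_f_l]; use T_A_less_T_B C_0 in simp)+

lemma T0s: "T\<^sub>A D < T\<^sub>0\<^sub>s D" "T\<^sub>0\<^sub>s D < T\<^sub>B D" "f\<^sub>s D (T\<^sub>0\<^sub>s D) = C\<^sub>0 D"
  unfolding T\<^sub>0\<^sub>s_def
  by (rule the_inv_into_strict_mono_on[OF cont_f_s mono_f_s];
      use T_A_less_T_B C_0 curves_A curves_B in simp)+

lemma T0s_less_T0l: "T\<^sub>0\<^sub>s D < T\<^sub>0\<^sub>l D"
  using curves_between[OF T0s(1,2)] T0s T0l f_l_less_iff[of "T\<^sub>0\<^sub>s D" "T\<^sub>0\<^sub>l D"] by simp

lemma T0l_less_T0: "T\<^sub>0\<^sub>l D < T\<^sub>0 D"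
  using initially_liquid T_0 T0l f_l_less_iff[of "T\<^sub>0\<^sub>l D" "T\<^sub>0 D"] by simp

text \<open>On this interval $\phi(T) = 1 + (f_s(T) - C_0)/(C_0 - f_l(T))$, where the numerator is
  nonnegative and increases while the denominator is positive and decreases.\<close>
lemma phi_strict_mono:
  assumes "T\<^sub>0\<^sub>s D \<le> x" "x < y" "y < T\<^sub>0\<^sub>l D"
  shows "\<phi> D x < \<phi> D y"
proof -
  have mem: "x \<in> {T\<^sub>A D..T\<^sub>B D}" "y \<in> {T\<^sub>A D..T\<^sub>B D}" "T\<^sub>0\<^sub>l D \<in> {T\<^sub>A D..T\<^sub>B D}" "T\<^sub>0\<^sub>s D \<in> {T\<^sub>A D..T\<^sub>B D}"
    using assms T0l T0s by auto
  have l: "f\<^sub>l D x < f\<^sub>l D y" "f\<^sub>l D y < C\<^sub>0 D"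
    using assms mem f_l_less_iff T0l(3) by metis+
  have s: "f\<^sub>s D x < f\<^sub>s D y" "C\<^sub>0 D \<le> f\<^sub>s D x"
    using assms mem f_s_less_iff T0s(3) by (metis, metis leD leI)
  have "(f\<^sub>s D x - C\<^sub>0 D) / (C\<^sub>0 D - f\<^sub>l D x) < (f\<^sub>s D y - C\<^sub>0 D) / (C\<^sub>0 D - f\<^sub>l D y)"
    using l s by (intro frac_less) auto
  moreover have "\<phi> D z = 1 + (f\<^sub>s D z - C\<^sub>0 D) / (C\<^sub>0 D - f\<^sub>l D z)" if "f\<^sub>l D z < C\<^sub>0 D" for z
    using that by (simp add: \<phi>_def field_simps)
  ultimately show ?thesis
    using l by simp
qed

text \<open>Above $T_{0l}$ the denominator of $\phi$ is negative, so $\phi$ is; below $T_{0l}$ the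
  inequality says $f_s(T) > C_0$.\<close>
lemma between_liquidus_and_solidus_if_phi_greater_1:
  assumes "T\<^sub>A D < T" "T < T\<^sub>B D" "T \<noteq> T\<^sub>0\<^sub>l D" "1 < \<phi> D T"
  shows "T\<^sub>0\<^sub>s D < T" "T < T\<^sub>0\<^sub>l D"
proof -
  have gap: "f\<^sub>l D T < f\<^sub>s D T"
    using curves_between assms by blast
  have "0 < C\<^sub>0 D - f\<^sub>l D T"
  proof (rule ccontr)
    assume "\<not> 0 < C\<^sub>0 D - f\<^sub>l D T"
    then have "\<phi> D T \<le> 0"
      using gap by (simp add: \<phi>_def divide_nonneg_nonpos)
    with assms show False by simp
  qed
  with assms have "C\<^sub>0 D < f\<^sub>s D T"
    by (simp add: \<phi>_def less_divide_eq)
  then show "T\<^sub>0\<^sub>s D < T"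
    using f_s_less_iff[of "T\<^sub>0\<^sub>s D" T] T0s assms by simp
  show "T < T\<^sub>0\<^sub>l D"
    using f_l_less_iff[of T "T\<^sub>0\<^sub>l D"] T0l assms \<open>0 < C\<^sub>0 D - f\<^sub>l D T\<close> by simp
qed

lemma M_greater_1: "0 < x \<Longrightarrow> 1 < M D x"
  using pos Q_pos[of "sqrt (\<alpha>\<^sub>s D / d\<^sub>l D) * x"] Q_less_1[of "sqrt (\<alpha>\<^sub>s D / d\<^sub>l D) * x"]
  by (simp add: M_def one_less_inverse)

lemma M_strict_antimono:
  assumes "0 < x" "x < y"
  shows "M D y < M D x"
  unfolding M_def using assms pos Q_pos[of "sqrt (\<alpha>\<^sub>s D / d\<^sub>l D) * x"]
  by (intro less_imp_inverse_less) (auto simp: strict_mono_less[OF strict_mono_Q])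

end

section \<open>The coupled system for the front coefficient and the interface temperature\<close>

context convective_alloy
begin

text \<open>Otherwise the upper bound for $h_0$ would not be positive.\<close>
lemma T_inf_less_T0s: "T_inf D < T\<^sub>0\<^sub>s D"
proof (rule ccontr)
  assume "\<not> T_inf D < T\<^sub>0\<^sub>s D"
  then have "(T\<^sub>0 D - T\<^sub>0\<^sub>s D) * k\<^sub>l D / ((T\<^sub>0\<^sub>s D - T_inf D) * sqrt (pi * \<alpha>\<^sub>l D)) \<le> 0"
    using T0s_less_T0l T0l_less_T0 pos
    by (intro divide_nonneg_nonpos mult_nonneg_nonneg mult_nonpos_nonneg) auto
  then show False
    using h0_upper h0_pos by linarith
qed

lemma temperature_order: "T_inf D < T\<^sub>0\<^sub>s D" "T_inf D < T\<^sub>0\<^sub>l D" "T_inf D < T\<^sub>0 D" "T\<^sub>0\<^sub>s D < T\<^sub>0 D"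
  using T_inf_less_T0s T0s_less_T0l T0l_less_T0 by auto

lemma solid_resistance_pos: "0 \<le> x \<Longrightarrow> 0 < k\<^sub>s D + h0 * sqrt (pi * \<alpha>\<^sub>s D) * erf x"
  using pos h0_pos erf_pos[of x] by (cases "x = 0") (auto intro!: add_pos_nonneg)

lemma F2_pos: "0 \<le> x \<Longrightarrow> 0 < F\<^sub>2 D h0 x"
  unfolding F\<^sub>2_def using pos h0_pos solid_resistance_pos[of x] F1_pos
  by (intro divide_pos_pos mult_pos_pos) auto

lemma F2_strict_antimono:
  assumes "0 \<le> x" "x < y"
  shows "F\<^sub>2 D h0 y < F\<^sub>2 D h0 x"
proof -
  let ?r = "sqrt (\<alpha>\<^sub>s D / \<alpha>\<^sub>l D)"
  have "F\<^sub>1 (?r * y) < F\<^sub>1 (?r * x)"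
    using assms pos by (intro F1_strict_antimono) auto
  moreover have "exp (- y\<^sup>2) < exp (- x\<^sup>2)"
    using assms by (simp add: power_strict_mono)
  ultimately have "exp (- y\<^sup>2) * F\<^sub>1 (?r * y) < exp (- x\<^sup>2) * F\<^sub>1 (?r * x)"
    using F1_pos by (intro mult_strict_mono) (auto intro: less_imp_le)
  then have "h0 * k\<^sub>s D * sqrt (pi * \<alpha>\<^sub>l D) * exp (- y\<^sup>2) * F\<^sub>1 (?r * y) <
      h0 * k\<^sub>s D * sqrt (pi * \<alpha>\<^sub>l D) * exp (- x\<^sup>2) * F\<^sub>1 (?r * x)"
    using pos h0_pos by (simp add: mult.assoc)
  moreover have "k\<^sub>l D * (k\<^sub>s D + h0 * sqrt (pi * \<alpha>\<^sub>s D) * erf x) <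
      k\<^sub>l D * (k\<^sub>s D + h0 * sqrt (pi * \<alpha>\<^sub>s D) * erf y)"
    using pos h0_pos assms by simp
  moreover have "0 < k\<^sub>l D * (k\<^sub>s D + h0 * sqrt (pi * \<alpha>\<^sub>s D) * erf x)"
    using pos solid_resistance_pos[OF assms(1)] by simp
  moreover have "0 \<le> h0 * k\<^sub>s D * sqrt (pi * \<alpha>\<^sub>l D) * exp (- y\<^sup>2) * F\<^sub>1 (?r * y)"
    using pos h0_pos F1_pos[of "?r * y"] by simp
  ultimately show ?thesis
    unfolding F\<^sub>2_def by (intro frac_less) auto
qed

lemma continuous_on_F2: "continuous_on {0..} (F\<^sub>2 D h0)"
  unfolding F\<^sub>2_def[abs_def] using pos solid_resistance_pos
  by (auto intro!: continuous_intros simp: less_imp_neq[THEN not_sym])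

lemma F2_at_top: "(F\<^sub>2 D h0 \<longlongrightarrow> 0) at_top"
proof (rule tendsto_sandwich)
  define c where "c = h0 * sqrt (pi * \<alpha>\<^sub>l D) / k\<^sub>l D"
  show "\<forall>\<^sub>F x in at_top. 0 \<le> F\<^sub>2 D h0 x"
    using eventually_ge_at_top[of 0] by eventually_elim (simp add: F2_pos less_imp_le)
  show "\<forall>\<^sub>F x in at_top. F\<^sub>2 D h0 x \<le> c * exp (- x\<^sup>2)"
    using eventually_gt_at_top[of 0]
  proof eventually_elim
    case (elim x)
    have "F\<^sub>1 (sqrt (\<alpha>\<^sub>s D / \<alpha>\<^sub>l D) * x) < F\<^sub>1 0"
      using elim pos by (intro F1_strict_antimono) auto
    then have "F\<^sub>1 (sqrt (\<alpha>\<^sub>s D / \<alpha>\<^sub>l D) * x) \<le> 1"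
      by (simp add: F\<^sub>1_def)
    then have "h0 * k\<^sub>s D * sqrt (pi * \<alpha>\<^sub>l D) * exp (- x\<^sup>2) * F\<^sub>1 (sqrt (\<alpha>\<^sub>s D / \<alpha>\<^sub>l D) * x) \<le>
        h0 * k\<^sub>s D * sqrt (pi * \<alpha>\<^sub>l D) * exp (- x\<^sup>2) * 1"
      using pos h0_pos by (intro mult_left_mono) auto
    moreover have "k\<^sub>l D * k\<^sub>s D \<le> k\<^sub>l D * (k\<^sub>s D + h0 * sqrt (pi * \<alpha>\<^sub>s D) * erf x)"
      using elim pos h0_pos erf_pos[of x] by simp
    ultimately have "F\<^sub>2 D h0 x \<le> h0 * k\<^sub>s D * sqrt (pi * \<alpha>\<^sub>l D) * exp (- x\<^sup>2) * 1 / (k\<^sub>l D * k\<^sub>s D)"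
      unfolding F\<^sub>2_def using pos h0_pos by (intro frac_le) auto
    also have "\<dots> = c * exp (- x\<^sup>2)"
      using pos by (simp add: c_def)
    finally show ?case .
  qed
  have "((\<lambda>x::real. exp (- x\<^sup>2)) \<longlongrightarrow> 0) at_top"
    by real_asymp
  then show "((\<lambda>x. c * exp (- x\<^sup>2)) \<longlongrightarrow> 0) at_top"
    by (rule tendsto_mult_right_zero)
qed simp

text \<open>Both summands of $H$ carry the factor $1/x$. Pulling it out shows that $1/H$ extends
  continuously by $0$ to $x = 0$.\<close>
lemma H_eq:
  assumes "0 < x"
  shows "H D h0 x = k\<^sub>l D * (F\<^sub>2 D h0 x + 1) / (x * F\<^sub>1 (sqrt (\<alpha>\<^sub>s D / \<alpha>\<^sub>l D) * x))"
proof -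
  define r where "r = sqrt (\<alpha>\<^sub>s D / \<alpha>\<^sub>l D)"
  define K where "K = k\<^sub>s D + h0 * sqrt (pi * \<alpha>\<^sub>s D) * erf x"
  have nz: "F\<^sub>1 (r * x) \<noteq> 0" "K \<noteq> 0"
    using F1_pos[of "r * x"] solid_resistance_pos[of x] assms by (auto simp: K_def)
  have "k\<^sub>l D * (F\<^sub>2 D h0 x + 1) / (x * F\<^sub>1 (r * x)) =
      h0 * k\<^sub>s D * sqrt (pi * \<alpha>\<^sub>l D) / (x * exp (x\<^sup>2) * K) + k\<^sub>l D / (x * F\<^sub>1 (r * x))"
    unfolding F\<^sub>2_def r_def[symmetric] K_def[symmetric] using nz pos assms
    by (simp add: field_simps exp_minus)
  also have "k\<^sub>l D / (x * F\<^sub>1 (r * x)) = k\<^sub>l D * sqrt (pi * \<alpha>\<^sub>s D) / (sqrt (\<alpha>\<^sub>l D) * Q (r * x))"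
    using nz pos assms by (simp add: Q_eq_F1 r_def real_sqrt_mult real_sqrt_divide)
  finally show ?thesis
    by (simp add: H_def r_def K_def)
qed

text \<open>In this form $W$ is visibly monotone, and continuous up to $0$. The equation holds at $0$ as
  well: there $H$ has the default value $0$, so the last summand of $W$ vanishes, as it does in the
  limit.\<close>
lemma W_eq:
  assumes "0 \<le> x"
  shows "W D h0 x = T_inf D +
    (T\<^sub>0 D - T_inf D + \<gamma> D * \<rho> D * \<alpha>\<^sub>l D / k\<^sub>l D * Q (sqrt (\<alpha>\<^sub>s D / \<alpha>\<^sub>l D) * x)) / (F\<^sub>2 D h0 x + 1)"
proof (cases "x = 0")
  case True
  then show ?thesis by (simp add: W_def H_def Q_def)
next
  case False
  with assms have x: "0 < x" by simp
  define r where "r = sqrt (\<alpha>\<^sub>s D / \<alpha>\<^sub>l D)"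
  have "sqrt (pi * \<alpha>\<^sub>s D * \<alpha>\<^sub>l D) * (x * F\<^sub>1 (r * x)) = \<alpha>\<^sub>l D * Q (r * x)"
    using pos by (simp add: Q_eq_F1 r_def real_sqrt_mult real_sqrt_divide field_simps)
  then have "\<gamma> D * \<rho> D * sqrt (pi * \<alpha>\<^sub>s D * \<alpha>\<^sub>l D) / H D h0 x =
      \<gamma> D * \<rho> D * \<alpha>\<^sub>l D / k\<^sub>l D * Q (r * x) / (F\<^sub>2 D h0 x + 1)"
    unfolding H_eq[OF x] r_def[symmetric] by (simp add: mult.assoc)
  then show ?thesis
    by (simp add: W_def r_def add_divide_distrib)
qed

lemma W_strict_mono:
  assumes "0 \<le> x" "x < y"
  shows "W D h0 x < W D h0 y"
proof -
  let ?r = "sqrt (\<alpha>\<^sub>s D / \<alpha>\<^sub>l D)"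
  have "0 \<le> Q (?r * x)" 
    using assms pos Q_pos[of "?r * x"] by (cases "x = 0") (auto simp: Q_def[of 0])
  moreover have "\<gamma> D * \<rho> D * \<alpha>\<^sub>l D / k\<^sub>l D * Q (?r * x) < \<gamma> D * \<rho> D * \<alpha>\<^sub>l D / k\<^sub>l D * Q (?r * y)"
    using assms pos by (intro mult_strict_left_mono strict_monoD[OF strict_mono_Q]) auto
  moreover have "F\<^sub>2 D h0 y < F\<^sub>2 D h0 x" "0 < F\<^sub>2 D h0 y"
    using F2_strict_antimono F2_pos assms by auto
  ultimately show ?thesis
    unfolding W_eq[OF assms(1)] W_eq[OF less_imp_le[OF le_less_trans[OF assms]]]
    using pos temperature_order by (intro add_strict_left_mono frac_less) simp_all
qed

lemma continuous_on_W: "continuous_on {0..} (W D h0)"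
proof -
  have "continuous_on {0..} (\<lambda>x. T_inf D +
    (T\<^sub>0 D - T_inf D + \<gamma> D * \<rho> D * \<alpha>\<^sub>l D / k\<^sub>l D * Q (sqrt (\<alpha>\<^sub>s D / \<alpha>\<^sub>l D) * x)) / (F\<^sub>2 D h0 x + 1))"
    unfolding Q_eq_F1 using F2_pos
    by (intro continuous_intros continuous_on_F2) (auto simp: add_pos_pos less_imp_neq[THEN not_sym])
  then show ?thesis
    by (rule continuous_on_eq) (simp add: W_eq)
qed

text \<open>Since $F_2(0) = h_0\sqrt{\pi\alpha_l}/k_l$, these two inequalities are the two bounds on
  $h_0$, solved for $W(0)$.\<close>
lemma W_0_bounds: "T\<^sub>0\<^sub>s D < W D h0 0" "W D h0 0 < T\<^sub>0\<^sub>l D"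
proof -
  define c where "c = h0 * sqrt (pi * \<alpha>\<^sub>l D) / k\<^sub>l D"
  have "F\<^sub>2 D h0 0 = c"
    using pos by (simp add: F\<^sub>2_def F\<^sub>1_def c_def)
  then have W0: "W D h0 0 = T_inf D + (T\<^sub>0 D - T_inf D) / (c + 1)"
    by (simp add: W_eq Q_def)
  have c: "c > 0"
    using h0_pos pos by (simp add: c_def)
  have "c * (T\<^sub>0\<^sub>s D - T_inf D) < T\<^sub>0 D - T\<^sub>0\<^sub>s D"
    using h0_upper pos temperature_order by (simp add: c_def field_simps)
  then show "T\<^sub>0\<^sub>s D < W D h0 0"
    using c by (simp add: W0 field_simps)
  have "T\<^sub>0 D - T\<^sub>0\<^sub>l D < c * (T\<^sub>0\<^sub>l D - T_inf D)"
    using h0_lower pos temperature_order by (simp add: c_def field_simps)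
  then show "W D h0 0 < T\<^sub>0\<^sub>l D"
    using c by (simp add: W0 field_simps)
qed

lemma W_reaches_T0l: obtains X where "0 < X" "W D h0 X = T\<^sub>0\<^sub>l D"
proof -
  have "((\<lambda>x. T_inf D + (T\<^sub>0 D - T_inf D) / (F\<^sub>2 D h0 x + 1)) \<longlongrightarrow>
      T_inf D + (T\<^sub>0 D - T_inf D) / (0 + 1)) at_top"
    by (intro tendsto_intros F2_at_top) simp
  then have "\<forall>\<^sub>F x in at_top. T\<^sub>0\<^sub>l D < T_inf D + (T\<^sub>0 D - T_inf D) / (F\<^sub>2 D h0 x + 1)"
    using T0l_less_T0 by (intro order_tendstoD(1)) auto
  then obtain Y where Y: "0 < Y" "T\<^sub>0\<^sub>l D < T_inf D + (T\<^sub>0 D - T_inf D) / (F\<^sub>2 D h0 Y + 1)"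
    using eventually_conj[OF eventually_gt_at_top[of 0]] eventually_happens[of _ at_top]
    by (metis (no_types, lifting) trivial_limit_at_top_linorder)
  have "T_inf D + (T\<^sub>0 D - T_inf D) / (F\<^sub>2 D h0 Y + 1) \<le> W D h0 Y"
    using Y(1) pos F2_pos[of Y] Q_pos[of "sqrt (\<alpha>\<^sub>s D / \<alpha>\<^sub>l D) * Y"]
    by (simp add: W_eq divide_right_mono)
  with Y have "T\<^sub>0\<^sub>l D < W D h0 Y" by simp
  then obtain X where "0 \<le> X" "W D h0 X = T\<^sub>0\<^sub>l D"
    using IVT'[of "W D h0" 0 "T\<^sub>0\<^sub>l D" Y] W_0_bounds(2) Y(1)
      continuous_on_subset[OF continuous_on_W, of "{0..Y}"] by force
  with W_0_bounds(2) that show thesis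
    by (metis less_irrefl order.order_iff_strict)
qed

text \<open>The equation $M = \phi \circ W$ is multiplied by both denominators, $Q$ and $C_0 - f_l$.
  The result makes sense at $x = 0$, where $M$ blows up, and at the point where $W$ reaches $T_{0l}$
  and $\phi$ blows up; it has opposite signs there.\<close>
lemma coupled_system_exists: "\<exists>\<delta> T. coupled_system D h0 \<delta> T"
proof -
  obtain X where X: "0 < X" "W D h0 X = T\<^sub>0\<^sub>l D"
    by (rule W_reaches_T0l)
  define q where "q = (\<lambda>x. Q (sqrt (\<alpha>\<^sub>s D / d\<^sub>l D) * x))"
  define g where "g = (\<lambda>x. (f\<^sub>s D (W D h0 x) - f\<^sub>l D (W D h0 x)) * q x -
      (C\<^sub>0 D - f\<^sub>l D (W D h0 x)))"
  have range: "T\<^sub>0\<^sub>s D < W D h0 x \<and> W D h0 x \<le> T\<^sub>0\<^sub>l D" if "x \<in> {0..X}" for x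
    using that W_strict_mono[of 0 x] W_strict_mono[of x X] W_0_bounds X
    by (cases "x = 0"; cases "x = X") auto
  have W_cont: "continuous_on {0..X} (W D h0)"
    by (rule continuous_on_subset[OF continuous_on_W]) auto
  have img: "W D h0 ` {0..X} \<subseteq> {T\<^sub>A D..T\<^sub>B D}"
    using range T0s T0l by fastforce
  have "continuous_on {0..X} q"
    unfolding q_def Q_eq_F1 by (intro continuous_intros)
  then have g_cont: "continuous_on {0..X} g"
    unfolding g_def
    by (intro continuous_intros continuous_on_compose2[OF cont_f_l W_cont img]
        continuous_on_compose2[OF cont_f_s W_cont img])
  have "g 0 < 0"
    using f_l_less_iff[of "W D h0 0" "T\<^sub>0\<^sub>l D"] W_0_bounds T0l T0s
    by (simp add: g_def q_def Q_def)
  moreover have "0 < g X"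
    using curves_between[OF T0l(1,2)] X pos
    by (simp add: g_def q_def T0l Q_pos)
  ultimately obtain \<delta> where \<delta>: "0 \<le> \<delta>" "\<delta> \<le> X" "g \<delta> = 0"
    using IVT'[of g 0 0 X] g_cont X by auto
  with \<open>g 0 < 0\<close> \<open>0 < g X\<close> have "0 < \<delta>" "\<delta> < X"
    by (auto simp: order.order_iff_strict)
  define T where "T = W D h0 \<delta>"
  have T: "T\<^sub>0\<^sub>s D < T" "T < T\<^sub>0\<^sub>l D"
    using range[of \<delta>] W_strict_mono[of \<delta> X] \<delta> \<open>\<delta> < X\<close> X by (auto simp: T_def)
  then have "f\<^sub>l D T < C\<^sub>0 D"
    using f_l_less_iff[of T "T\<^sub>0\<^sub>l D"] T0l T0s by simp
  moreover have "0 < q \<delta>"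
    using pos \<open>0 < \<delta>\<close> by (simp add: q_def Q_pos)
  ultimately have "inverse (q \<delta>) = \<phi> D T"
    using \<delta>(3) by (simp add: g_def \<phi>_def T_def field_simps)
  then have "coupled_system D h0 \<delta> T"
    using T T0s T0l \<open>0 < \<delta>\<close> by (simp add: coupled_system_def M_def q_def T_def)
  then show ?thesis by blast
qed

lemma coupled_system_unique:
  assumes "coupled_system D h0 \<delta> T" "coupled_system D h0 \<delta>' T'"
  shows "\<delta>' = \<delta> \<and> T' = T"
proof -
  have not_less: "\<not> x < y" if xy: "coupled_system D h0 x S" "coupled_system D h0 y S'" for x y S S'
  proof
    assume "x < y"
    have S: "0 < x" "T\<^sub>A D < S" "S < T\<^sub>B D" "S \<noteq> T\<^sub>0\<^sub>l D" "S = W D h0 x" "M D x = \<phi> D S"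
      and S': "0 < y" "T\<^sub>A D < S'" "S' < T\<^sub>B D" "S' \<noteq> T\<^sub>0\<^sub>l D" "S' = W D h0 y" "M D y = \<phi> D S'"
      using xy by (simp_all add: coupled_system_def)
    have "T\<^sub>0\<^sub>s D < S" "S' < T\<^sub>0\<^sub>l D"
      using between_liquidus_and_solidus_if_phi_greater_1[of S] between_liquidus_and_solidus_if_phi_greater_1[of S'] M_greater_1[of x] M_greater_1[of y] S S' by simp_all
    moreover have "S < S'"
      using W_strict_mono[of x y] S S' \<open>x < y\<close> by simp
    ultimately have "\<phi> D S < \<phi> D S'"
      by (intro phi_strict_mono) auto
    moreover have "M D y < M D x"
      by (rule M_strict_antimono[OF S(1) \<open>x < y\<close>])
    ultimately show False
      using S(6) S'(6) by simp
  qed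
  have "\<delta>' = \<delta>"
    using not_less[OF assms] not_less[OF assms(2,1)] by simp
  then show ?thesis
    using assms by (simp add: coupled_system_def)
qed

end

section \<open>Similarity profiles for the heat equation\<close>

definition similarity_profile :: "real \<Rightarrow> real \<Rightarrow> real \<Rightarrow> real \<Rightarrow> real \<Rightarrow> real" where
  "similarity_profile \<kappa> A B x t = A + B * erf (x / (2 * sqrt (\<kappa> * t)))"

lemma DERIV_similarity_profile_x:
  assumes "\<kappa> > 0" "t > 0"
  shows "((\<lambda>x. similarity_profile \<kappa> A B x t) has_real_derivative
    B * exp (- (x / (2 * sqrt (\<kappa> * t)))\<^sup>2) / sqrt (pi * \<kappa> * t)) (at x)"
  unfolding similarity_profile_def using assms
  by (auto intro!: derivative_eq_intros simp: real_sqrt_mult mult_ac)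

lemma deriv_similarity_profile_x:
  assumes "\<kappa> > 0" "t > 0"
  shows "deriv (\<lambda>x. similarity_profile \<kappa> A B x t) =
    (\<lambda>x. B * exp (- (x / (2 * sqrt (\<kappa> * t)))\<^sup>2) / sqrt (pi * \<kappa> * t))"
  using DERIV_imp_deriv[OF DERIV_similarity_profile_x[OF assms]] by blast

lemma solves_heat_at_similarity_profile:
  assumes "\<kappa> > 0" "t > 0"
  shows "solves_heat_at \<kappa> (similarity_profile \<kappa> A B) x t"
proof -
  define z where "z = x / (2 * sqrt (\<kappa> * t))"
  define c where "c = - (B * z * exp (- z\<^sup>2) / (sqrt pi * t))"
  have xx: "((\<lambda>x. B * exp (- (x / (2 * sqrt (\<kappa> * t)))\<^sup>2) / sqrt (pi * \<kappa> * t))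
      has_real_derivative c / \<kappa>) (at x)"
  proof -
    obtain w where w: "\<kappa> = w\<^sup>2" "0 < w"
      using assms(1) by (metis real_sqrt_gt_zero real_sqrt_pow2 less_imp_le)
    show ?thesis
      unfolding c_def z_def w(1) using assms(2) w(2)
      by (auto intro!: derivative_eq_intros simp: real_sqrt_mult power2_eq_square field_simps)
  qed
  have sq: "((\<lambda>\<tau>. sqrt (\<kappa> * \<tau>)) has_real_derivative sqrt (\<kappa> * t) / (2 * t)) (at t)"
    using assms
    by (auto intro!: derivative_eq_intros simp: field_simps real_sqrt_mult)
  have t: "((\<lambda>\<tau>. similarity_profile \<kappa> A B x \<tau>) has_real_derivative c) (at t)"
    unfolding c_def z_def similarity_profile_def using assms
    by (auto intro!: derivative_eq_intros sq simp: field_simps mult_less_0_iff)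
  show ?thesis
    unfolding solves_heat_at_def deriv_similarity_profile_x[OF assms]
    using DERIV_similarity_profile_x[OF assms] xx t DERIV_imp_deriv[OF xx] DERIV_imp_deriv[OF t] assms
    by (auto simp: real_differentiable_def)
qed

lemma tendsto_similarity_profile_x:
  "((\<lambda>x. similarity_profile \<kappa> A B x t) \<longlongrightarrow> similarity_profile \<kappa> A B x0 t) (at x0 within S)"
  unfolding similarity_profile_def divide_inverse by (intro tendsto_intros)

lemma tendsto_deriv_similarity_profile_x:
  assumes "\<kappa> > 0" "t > 0"
  shows "(deriv (\<lambda>x. similarity_profile \<kappa> A B x t) \<longlongrightarrow>
    B * exp (- (x0 / (2 * sqrt (\<kappa> * t)))\<^sup>2) / sqrt (pi * \<kappa> * t)) (at x0 within S)"
  unfolding deriv_similarity_profile_x[OF assms] divide_inverse by (intro tendsto_intros)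

lemma similarity_profile_at_infinity:
  assumes "\<kappa> > 0" "t > 0"
  shows "((\<lambda>x. similarity_profile \<kappa> A B x t) \<longlongrightarrow> A + B) at_top"
proof -
  have "0 < 2 * sqrt (\<kappa> * t)" using assms by simp
  then have "filterlim (\<lambda>x. x / (2 * sqrt (\<kappa> * t))) at_top at_top"
    by (subst divide_inverse, subst mult.commute)
      (intro filterlim_tendsto_pos_mult_at_top[OF tendsto_const] filterlim_ident, simp)
  from filterlim_compose[OF erf_at_top this]
  have "((\<lambda>x. A + B * erf (x / (2 * sqrt (\<kappa> * t)))) \<longlongrightarrow> A + B * 1) at_top"
    by (intro tendsto_intros)
  then show ?thesis by (simp add: similarity_profile_def)
qed

lemma similarity_profile_initial:
  assumes "\<kappa> > 0" "x > 0" "S \<subseteq> {0<..}"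
  shows "((\<lambda>t. similarity_profile \<kappa> A B x t) \<longlongrightarrow> A + B) (at 0 within S)"
proof -
  have "filterlim (\<lambda>t. x / (2 * sqrt (\<kappa> * t))) at_top (at_right 0)"
    using assms by real_asymp
  from filterlim_compose[OF erf_at_top this]
  have "((\<lambda>t. A + B * erf (x / (2 * sqrt (\<kappa> * t)))) \<longlongrightarrow> A + B * 1) (at_right 0)"
    by (intro tendsto_intros)
  then show ?thesis
    using tendsto_within_subset assms(3) by (fastforce simp: similarity_profile_def)
qed

lemma deriv_cong_open:
  assumes "open S" "x \<in> S" "\<And>y. y \<in> S \<Longrightarrow> f y = g y"
  shows "deriv f x = deriv g x"
  using assms by (intro deriv_cong_ev refl eventually_nhds_in_open[THEN eventually_mono]) auto

text \<open>The unknowns are prescribed only inside their phase, and their boundary values are one-sided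
  limits. A function that is a profile on an interval has the boundary values of that profile,
  for itself and for its derivative.\<close>
lemma one_sided_limit_similarity_profile:
  assumes "\<kappa> > 0" "t > 0" "a < b"
    and F: "F = at_right a \<and> x0 = a \<or> F = at_left b \<and> x0 = b"
    and eq: "\<And>x. a < x \<Longrightarrow> x < b \<Longrightarrow> u x = similarity_profile \<kappa> A B x t"
  shows "(u \<longlongrightarrow> v) F \<Longrightarrow> v = similarity_profile \<kappa> A B x0 t"
    and "(deriv u \<longlongrightarrow> g) F \<Longrightarrow>
      g = B * exp (- (x0 / (2 * sqrt (\<kappa> * t)))\<^sup>2) / sqrt (pi * \<kappa> * t)"
proof -
  have inside: "\<forall>\<^sub>F x in F. x \<in> {a<..<b}"
    using F eventually_at_right_real[OF \<open>a < b\<close>] eventually_at_left_real[OF \<open>a < b\<close>] by auto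
  have nontrivial: "F \<noteq> bot" and at_x0: "\<exists>R. F = at x0 within R"
    using F trivial_limit_at_left_real trivial_limit_at_right_real by metis+
  show "v = similarity_profile \<kappa> A B x0 t" if "(u \<longlongrightarrow> v) F"
  proof (rule tendsto_unique[OF nontrivial])
    show "((\<lambda>x. similarity_profile \<kappa> A B x t) \<longlongrightarrow> v) F"
      by (rule Lim_transform_eventually[OF that]) (use inside eq in \<open>auto elim: eventually_mono\<close>)
    show "((\<lambda>x. similarity_profile \<kappa> A B x t) \<longlongrightarrow> similarity_profile \<kappa> A B x0 t) F"
      using at_x0 tendsto_similarity_profile_x by auto
  qed
  show "g = B * exp (- (x0 / (2 * sqrt (\<kappa> * t)))\<^sup>2) / sqrt (pi * \<kappa> * t)"
    if "(deriv u \<longlongrightarrow> g) F"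
  proof (rule tendsto_unique[OF nontrivial])
    have "deriv u x = deriv (\<lambda>y. similarity_profile \<kappa> A B y t) x" if "x \<in> {a<..<b}" for x
      using open_greaterThanLessThan that by (rule deriv_cong_open) (use eq in auto)
    then show "(deriv (\<lambda>x. similarity_profile \<kappa> A B x t) \<longlongrightarrow> g) F"
      by (intro Lim_transform_eventually[OF that]) (use inside in \<open>auto elim: eventually_mono\<close>)
    show "(deriv (\<lambda>x. similarity_profile \<kappa> A B x t) \<longlongrightarrow>
        B * exp (- (x0 / (2 * sqrt (\<kappa> * t)))\<^sup>2) / sqrt (pi * \<kappa> * t)) F"
      using at_x0 tendsto_deriv_similarity_profile_x[OF assms(1,2)] by auto
  qed
qed

lemmas limit_at_left_end = one_sided_limit_similarity_profile[OF _ _ _ disjI1[OF conjI[OF refl refl]]]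
lemmas limit_at_right_end = one_sided_limit_similarity_profile[OF _ _ _ disjI2[OF conjI[OF refl refl]]]

lemma DERIV_parabolic_front:
  assumes "\<alpha> > 0" "t > 0"
  shows "((\<lambda>t. 2 * \<delta> * sqrt (\<alpha> * t)) has_real_derivative \<delta> * sqrt \<alpha> / sqrt t) (at t)"
proof -
  have "((\<lambda>t. 2 * \<delta> * sqrt \<alpha> * sqrt t) has_real_derivative 2 * \<delta> * sqrt \<alpha> * (inverse (sqrt t) / 2)) (at t)"
    by (rule DERIV_cmult[OF DERIV_real_sqrt[OF assms(2)]])
  moreover have "2 * \<delta> * sqrt \<alpha> * (inverse (sqrt t) / 2) = \<delta> * sqrt \<alpha> / sqrt t"
    by (simp only: divide_inverse) simp
  ultimately show ?thesis
    by (simp only: real_sqrt_mult mult.assoc)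
qed

lemma similarity_variable_at_front:
  assumes "\<alpha> > 0" "\<kappa> > 0" "t > 0"
  shows "2 * \<delta> * sqrt (\<alpha> * t) / (2 * sqrt (\<kappa> * t)) = sqrt (\<alpha> / \<kappa>) * \<delta>"
  using assms by (simp add: real_sqrt_mult real_sqrt_divide)

section \<open>Conservation of heat and solute at the front\<close>

context convective_alloy
begin

text \<open>The factors of \<open>erf\<close> in the three nonconstant profiles, as they follow from the values at the
  front and the conditions at the wall and in the bulk liquid.\<close>
definition solid_heat_coeff :: "real \<Rightarrow> real \<Rightarrow> real" where
  "solid_heat_coeff \<delta> T =
     h0 * sqrt (pi * \<alpha>\<^sub>s D) * (T - T_inf D) / (k\<^sub>s D + h0 * sqrt (pi * \<alpha>\<^sub>s D) * erf \<delta>)"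

definition liquid_heat_coeff :: "real \<Rightarrow> real \<Rightarrow> real" where
  "liquid_heat_coeff \<delta> T = (T\<^sub>0 D - T) / erfc (sqrt (\<alpha>\<^sub>s D / \<alpha>\<^sub>l D) * \<delta>)"

definition liquid_solute_coeff :: "real \<Rightarrow> real \<Rightarrow> real" where
  "liquid_solute_coeff \<delta> T = (C\<^sub>0 D - f\<^sub>l D T) / erfc (sqrt (\<alpha>\<^sub>s D / d\<^sub>l D) * \<delta>)"

text \<open>The heat balance at the front is multiplied by
  $\sqrt t\,\sqrt{\pi\alpha_l}\,F_1(r\delta)/k_l$ with $r = \sqrt{\alpha_s/\alpha_l}$. It becomes
  $F_2(\delta)(T - T_\infty) - (T_0 - T) = c\,Q(r\delta)$ with $c = \gamma\rho\alpha_l/k_l$,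
  which is linear in $T$; its solution is $W(\delta)$.\<close>
lemma heat_balance_iff:
  assumes "0 < \<delta>" "0 < t"
  shows "k\<^sub>s D * (solid_heat_coeff \<delta> T * exp (- \<delta>\<^sup>2) / sqrt (pi * \<alpha>\<^sub>s D * t)) -
      k\<^sub>l D * (liquid_heat_coeff \<delta> T * exp (- (sqrt (\<alpha>\<^sub>s D / \<alpha>\<^sub>l D) * \<delta>)\<^sup>2) / sqrt (pi * \<alpha>\<^sub>l D * t)) =
      \<gamma> D * \<rho> D * (\<delta> * sqrt (\<alpha>\<^sub>s D) / sqrt t) \<longleftrightarrow> T = W D h0 \<delta>"
    (is "?S - ?L = ?R \<longleftrightarrow> _")
proof -
  define r where "r = sqrt (\<alpha>\<^sub>s D / \<alpha>\<^sub>l D)"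
  define X where "X = sqrt t * sqrt (pi * \<alpha>\<^sub>l D) * F\<^sub>1 (r * \<delta>) / k\<^sub>l D"
  have K: "0 < k\<^sub>s D + h0 * sqrt (pi * \<alpha>\<^sub>s D) * erf \<delta>"
    using solid_resistance_pos assms by simp
  have "X > 0"
    using assms pos F1_pos by (simp add: X_def)
  have S: "?S * X = F\<^sub>2 D h0 \<delta> * (T - T_inf D)"
    using assms pos K by (simp add: solid_heat_coeff_def X_def F\<^sub>2_def r_def real_sqrt_mult mult_ac)
  have L: "?L * X = T\<^sub>0 D - T"
    using assms pos
    by (simp add: liquid_heat_coeff_def X_def F\<^sub>1_def exp_minus real_sqrt_mult flip: r_def)
  have R: "?R * X = \<gamma> D * \<rho> D * \<alpha>\<^sub>l D / k\<^sub>l D * Q (r * \<delta>)"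
    using assms pos
    by (simp add: X_def Q_eq_F1 real_sqrt_mult real_sqrt_divide r_def field_simps)
  have F2: "F\<^sub>2 D h0 \<delta> + 1 > 0"
    using F2_pos[of \<delta>] assms by simp
  have "?S - ?L = ?R \<longleftrightarrow> (?S - ?L) * X = ?R * X"
    using \<open>X > 0\<close> by (subst mult_cancel_right) auto
  also have "\<dots> \<longleftrightarrow> F\<^sub>2 D h0 \<delta> * (T - T_inf D) - (T\<^sub>0 D - T) =
      \<gamma> D * \<rho> D * \<alpha>\<^sub>l D / k\<^sub>l D * Q (r * \<delta>)"
    by (simp only: left_diff_distrib[of ?S] S L R)
  also have "\<dots> \<longleftrightarrow> (T - T_inf D) * (F\<^sub>2 D h0 \<delta> + 1) =
      T\<^sub>0 D - T_inf D + \<gamma> D * \<rho> D * \<alpha>\<^sub>l D / k\<^sub>l D * Q (r * \<delta>)"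
    by (auto simp add: algebra_simps)
  also have "\<dots> \<longleftrightarrow> T - T_inf D =
      (T\<^sub>0 D - T_inf D + \<gamma> D * \<rho> D * \<alpha>\<^sub>l D / k\<^sub>l D * Q (r * \<delta>)) / (F\<^sub>2 D h0 \<delta> + 1)"
    using F2 by (subst eq_divide_eq) auto
  also have "\<dots> \<longleftrightarrow> T = W D h0 \<delta>"
    unfolding W_eq[OF less_imp_le[OF assms(1)]] r_def by linarith
  finally show ?thesis .
qed

text \<open>After multiplication by $\sqrt t\,\sqrt\pi\,F_1(r\delta)/\sqrt{d_l}$, where now
  $r = \sqrt{\alpha_s/d_l}$, the solute balance reads
  $C_0 - f_l(T) = (f_s(T) - f_l(T))\,Q(r\delta)$. The right-hand side is positive, which excludes
  $T = T_{0l}$ and permits division.\<close>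
lemma solute_balance_iff:
  assumes "0 < \<delta>" "0 < t" "T\<^sub>A D < T" "T < T\<^sub>B D"
  shows "d\<^sub>l D * (liquid_solute_coeff \<delta> T * exp (- (sqrt (\<alpha>\<^sub>s D / d\<^sub>l D) * \<delta>)\<^sup>2) / sqrt (pi * d\<^sub>l D * t)) =
      (f\<^sub>s D T - f\<^sub>l D T) * (\<delta> * sqrt (\<alpha>\<^sub>s D) / sqrt t) \<longleftrightarrow> T \<noteq> T\<^sub>0\<^sub>l D \<and> M D \<delta> = \<phi> D T"
    (is "?L = ?R \<longleftrightarrow> _")
proof -
  define r where "r = sqrt (\<alpha>\<^sub>s D / d\<^sub>l D)"
  define X where "X = sqrt t * sqrt pi * F\<^sub>1 (r * \<delta>) / sqrt (d\<^sub>l D)"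
  have "X > 0"
    using assms pos F1_pos by (simp add: X_def)
  obtain w where w: "d\<^sub>l D = w\<^sup>2" "0 < w"
    using pos(4) by (metis real_sqrt_gt_zero real_sqrt_pow2 less_imp_le)
  have L: "?L * X = C\<^sub>0 D - f\<^sub>l D T"
    unfolding liquid_solute_coeff_def X_def F\<^sub>1_def r_def[symmetric]
    unfolding w(1)
    using assms(2) w(2) by (simp add: exp_minus real_sqrt_mult power2_eq_square)
  have R: "?R * X = (f\<^sub>s D T - f\<^sub>l D T) * Q (r * \<delta>)"
    using assms pos
    by (simp add: X_def Q_eq_F1 real_sqrt_divide r_def)
  have Q: "Q (r * \<delta>) > 0"
    using assms pos by (simp add: r_def Q_pos)
  have gap: "f\<^sub>l D T < f\<^sub>s D T"
    using curves_between assms by blast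
  have quotient: "c = g * q \<longleftrightarrow> c \<noteq> 0 \<and> inverse q = g / c" if "0 < g" "0 < q" for c g q :: real
    using that by (cases "c = 0") (auto simp: divide_simps mult.commute)
  have "T \<noteq> T\<^sub>0\<^sub>l D \<longleftrightarrow> C\<^sub>0 D - f\<^sub>l D T \<noteq> 0"
  proof -
    have "f\<^sub>l D T = f\<^sub>l D (T\<^sub>0\<^sub>l D) \<longleftrightarrow> T = T\<^sub>0\<^sub>l D"
      by (rule inj_on_eq_iff[OF strict_mono_on_imp_inj_on[OF mono_f_l]]) (use T0l assms in simp_all)
    then show ?thesis
      unfolding T0l(3) by argo
  qed
  moreover have "?L = ?R \<longleftrightarrow> C\<^sub>0 D - f\<^sub>l D T = (f\<^sub>s D T - f\<^sub>l D T) * Q (r * \<delta>)"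
  proof -
    have "?L = ?R \<longleftrightarrow> ?L * X = ?R * X"
      using \<open>X > 0\<close> by (subst mult_cancel_right) auto
    then show ?thesis
      by (simp only: L R)
  qed
  moreover have "C\<^sub>0 D - f\<^sub>l D T = (f\<^sub>s D T - f\<^sub>l D T) * Q (r * \<delta>) \<longleftrightarrow>
      C\<^sub>0 D - f\<^sub>l D T \<noteq> 0 \<and> inverse (Q (r * \<delta>)) = \<phi> D T"
    unfolding \<phi>_def using Q gap by (intro quotient) simp_all
  ultimately show ?thesis
    unfolding M_def r_def[symmetric] by blast
qed

end

section \<open>Similarity solutions and the coupled system\<close>

lemma solves_P2D:
  assumes "solves_P2 D h0 s Tk Ts Tl Cs Cl"
  shows "T\<^sub>A D < Tk" "Tk < T\<^sub>B D"
    and "\<forall>t>0. s t > 0 \<and> s differentiable (at t)"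
    and "\<forall>t>0. \<exists>v g. ((\<lambda>x. Ts x t) \<longlongrightarrow> v) (at_right 0) \<and>
        ((\<lambda>x. deriv (\<lambda>y. Ts y t) x) \<longlongrightarrow> g) (at_right 0) \<and>
        k\<^sub>s D * g = h0 / sqrt t * (v - T_inf D)"
    and "\<forall>t>0. ((\<lambda>x. Ts x t) \<longlongrightarrow> Tk) (at_left (s t)) \<and> ((\<lambda>x. Tl x t) \<longlongrightarrow> Tk) (at_right (s t))"
    and "\<forall>t>0. ((\<lambda>x. Tl x t) \<longlongrightarrow> T\<^sub>0 D) at_top"
    and "\<forall>t>0. ((\<lambda>x. deriv (\<lambda>y. Cs y t) x) \<longlongrightarrow> 0) (at_right 0)"
    and "\<forall>t>0. ((\<lambda>x. Cs x t) \<longlongrightarrow> f\<^sub>s D Tk) (at_left (s t))"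
    and "\<forall>x>0. ((\<lambda>t. Cl x t) \<longlongrightarrow> C\<^sub>0 D) (at 0 within {t. 0 < t \<and> s t < x})"
    and "\<forall>t>0. ((\<lambda>x. Cl x t) \<longlongrightarrow> f\<^sub>l D Tk) (at_right (s t))"
    and "\<forall>t>0. \<exists>gs gl. ((\<lambda>x. deriv (\<lambda>y. Ts y t) x) \<longlongrightarrow> gs) (at_left (s t)) \<and>
        ((\<lambda>x. deriv (\<lambda>y. Tl y t) x) \<longlongrightarrow> gl) (at_right (s t)) \<and>
        k\<^sub>s D * gs - k\<^sub>l D * gl = \<gamma> D * \<rho> D * deriv s t"
    and "\<forall>t>0. \<exists>gs gl. ((\<lambda>x. deriv (\<lambda>y. Cs y t) x) \<longlongrightarrow> gs) (at_left (s t)) \<and>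
        ((\<lambda>x. deriv (\<lambda>y. Cl y t) x) \<longlongrightarrow> gl) (at_right (s t)) \<and>
        d\<^sub>l D * gl - d\<^sub>s D * gs = (f\<^sub>s D Tk - f\<^sub>l D Tk) * deriv s t"
  by (insert assms[unfolded solves_P2_def], (elim conjE, assumption)+)

context convective_alloy
begin

definition solid_temperature :: "real \<Rightarrow> real \<Rightarrow> real \<Rightarrow> real \<Rightarrow> real" where
  "solid_temperature \<delta> T = similarity_profile (\<alpha>\<^sub>s D)
     (T - solid_heat_coeff \<delta> T * erf \<delta>) (solid_heat_coeff \<delta> T)"

definition liquid_temperature :: "real \<Rightarrow> real \<Rightarrow> real \<Rightarrow> real \<Rightarrow> real" where
  "liquid_temperature \<delta> T = similarity_profile (\<alpha>\<^sub>l D)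
     (T\<^sub>0 D - liquid_heat_coeff \<delta> T) (liquid_heat_coeff \<delta> T)"

definition liquid_concentration :: "real \<Rightarrow> real \<Rightarrow> real \<Rightarrow> real \<Rightarrow> real" where
  "liquid_concentration \<delta> T = similarity_profile (d\<^sub>l D)
     (C\<^sub>0 D - liquid_solute_coeff \<delta> T) (liquid_solute_coeff \<delta> T)"

text \<open>The coefficients of the profiles are chosen so that all conditions on the boundary hold, whatever
  $\delta > 0$ and $T$ are, apart from the two balances at the front; the coupled system provides these.\<close>
lemma similarity_solution_of_coupled_system:
  assumes "coupled_system D h0 \<delta> T"
  shows "similarity_solution D h0 (\<lambda>t. 2 * \<delta> * sqrt (\<alpha>\<^sub>s D * t)) T
    (solid_temperature \<delta> T) (liquid_temperature \<delta> T) (\<lambda>x t. f\<^sub>s D T) (liquid_concentration \<delta> T)"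
proof -
  define s where "s = (\<lambda>t. 2 * \<delta> * sqrt (\<alpha>\<^sub>s D * t))"
  define b1 b2 b4 where b: "b1 = solid_heat_coeff \<delta> T" "b2 = liquid_heat_coeff \<delta> T"
    "b4 = liquid_solute_coeff \<delta> T"
  define Ts where "Ts = similarity_profile (\<alpha>\<^sub>s D) (T - b1 * erf \<delta>) b1"
  define Tl where "Tl = similarity_profile (\<alpha>\<^sub>l D) (T\<^sub>0 D - b2) b2"
  define Cs where "Cs = similarity_profile (d\<^sub>s D) (f\<^sub>s D T) 0"
  define Cl where "Cl = similarity_profile (d\<^sub>l D) (C\<^sub>0 D - b4) b4"
  have \<delta>: "\<delta> > 0" and T: "T\<^sub>A D < T" "T < T\<^sub>B D" "T \<noteq> T\<^sub>0\<^sub>l D" "T = W D h0 \<delta>" "M D \<delta> = \<phi> D T"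
    using assms by (simp_all add: coupled_system_def)
  note front = similarity_variable_at_front[OF pos(1)]
  have s_deriv: "(s has_real_derivative \<delta> * sqrt (\<alpha>\<^sub>s D) / sqrt t) (at t)" if "t > 0" for t
    unfolding s_def by (rule DERIV_parabolic_front[OF pos(1) that])
  have K: "0 < k\<^sub>s D + h0 * sqrt (pi * \<alpha>\<^sub>s D) * erf \<delta>"
    using solid_resistance_pos \<delta> by simp
  have x_at: "2 * \<delta> * sqrt (\<alpha>\<^sub>s D * t) / (2 * sqrt (\<alpha>\<^sub>s D * t)) = \<delta>" if "t > 0" for t
    using front[OF pos(1) that, of \<delta>] pos by simp
  have Ts_front: "Ts (s t) t = T" if "t > 0" for t
    using x_at[OF that] by (simp add: Ts_def similarity_profile_def s_def)
  have Tl_front: "Tl (s t) t = T" if "t > 0" for t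
    unfolding Tl_def similarity_profile_def s_def front[OF pos(2) that] b
    by (simp add: liquid_heat_coeff_def divide_erfc_mult_erf del: times_divide_eq_left)
  have Cl_front: "Cl (s t) t = f\<^sub>l D T" if "t > 0" for t
    unfolding Cl_def similarity_profile_def s_def front[OF pos(4) that] b
    by (simp add: liquid_solute_coeff_def divide_erfc_mult_erf del: times_divide_eq_left)
  have convective: "k\<^sub>s D * (b1 * exp (- (0 / (2 * sqrt (\<alpha>\<^sub>s D * t)))\<^sup>2) / sqrt (pi * \<alpha>\<^sub>s D * t)) =
      h0 / sqrt t * (Ts 0 t - T_inf D)" if "t > 0" for t
  proof -
    have "k\<^sub>s D * b1 = h0 * sqrt (pi * \<alpha>\<^sub>s D) * (T - T_inf D) - h0 * sqrt (pi * \<alpha>\<^sub>s D) * erf \<delta> * b1"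
    proof -
      have "b1 * (k\<^sub>s D + h0 * sqrt (pi * \<alpha>\<^sub>s D) * erf \<delta>) = h0 * sqrt (pi * \<alpha>\<^sub>s D) * (T - T_inf D)"
        using K by (simp add: b solid_heat_coeff_def)
      then show ?thesis by (simp only: ring_distribs) algebra
    qed
    also have "\<dots> = h0 * (sqrt pi * sqrt (\<alpha>\<^sub>s D)) * (Ts 0 t - T_inf D)"
      by (simp add: Ts_def similarity_profile_def real_sqrt_mult algebra_simps)
    finally show ?thesis
      using that pos by (simp add: real_sqrt_mult divide_simps)
  qed
  have Ts_lim: "((\<lambda>x. Ts x t) \<longlongrightarrow> Ts x0 t) (at x0 within S)"
    and Tl_lim: "((\<lambda>x. Tl x t) \<longlongrightarrow> Tl x0 t) (at x0 within S)"
    and Cl_lim: "((\<lambda>x. Cl x t) \<longlongrightarrow> Cl x0 t) (at x0 within S)" for t x0 S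
    unfolding Ts_def Tl_def Cl_def by (rule tendsto_similarity_profile_x)+
  note deriv_lim = tendsto_deriv_similarity_profile_x
  have "solves_P2 D h0 s T Ts Tl Cs Cl"
    unfolding solves_P2_def
  proof (intro conjI allI impI)
    fix t :: real assume t: "t > 0"
    show "0 < s t" using \<delta> pos t by (simp add: s_def)
    show "s differentiable at t"
      using s_deriv[OF t] real_differentiable_def by blast
    show "\<exists>v g. ((\<lambda>x. Ts x t) \<longlongrightarrow> v) (at_right 0) \<and>
        (deriv (\<lambda>y. Ts y t) \<longlongrightarrow> g) (at_right 0) \<and>
        k\<^sub>s D * g = h0 / sqrt t * (v - T_inf D)"
    proof (intro exI conjI)
      show "((\<lambda>x. Ts x t) \<longlongrightarrow> Ts 0 t) (at_right 0)"
        by (rule Ts_lim)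
      show "(deriv (\<lambda>y. Ts y t) \<longlongrightarrow>
          b1 * exp (- (0 / (2 * sqrt (\<alpha>\<^sub>s D * t)))\<^sup>2) / sqrt (pi * \<alpha>\<^sub>s D * t)) (at_right 0)"
        unfolding Ts_def by (rule deriv_lim[OF pos(1) t])
    qed (rule convective[OF t])
    show "((\<lambda>x. Ts x t) \<longlongrightarrow> T) (at_left (s t))"
      using Ts_lim[of t "s t"] Ts_front[OF t] by simp
    show "((\<lambda>x. Tl x t) \<longlongrightarrow> T) (at_right (s t))"
      using Tl_lim[of t "s t"] Tl_front[OF t] by simp
    show "((\<lambda>x. Cl x t) \<longlongrightarrow> f\<^sub>l D T) (at_right (s t))"
      using Cl_lim[of t "s t"] Cl_front[OF t] by simp
    show "((\<lambda>x. Cs x t) \<longlongrightarrow> f\<^sub>s D T) (at_left (s t))"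
      by (simp add: Cs_def similarity_profile_def)
    show "(deriv (\<lambda>y. Cs y t) \<longlongrightarrow> 0) (at_right 0)"
      by (simp add: Cs_def similarity_profile_def)
    show "((\<lambda>x. Tl x t) \<longlongrightarrow> T\<^sub>0 D) at_top"
      using similarity_profile_at_infinity[OF pos(2) t, of "T\<^sub>0 D - b2" b2] by (simp add: Tl_def)
    show "\<exists>gs gl. (deriv (\<lambda>y. Ts y t) \<longlongrightarrow> gs) (at_left (s t)) \<and>
        (deriv (\<lambda>y. Tl y t) \<longlongrightarrow> gl) (at_right (s t)) \<and>
        k\<^sub>s D * gs - k\<^sub>l D * gl = \<gamma> D * \<rho> D * deriv s t"
    proof (intro exI conjI)
      show "(deriv (\<lambda>y. Ts y t) \<longlongrightarrow> b1 * exp (- \<delta>\<^sup>2) / sqrt (pi * \<alpha>\<^sub>s D * t)) (at_left (s t))"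
        using deriv_lim[OF pos(1) t, of _ b1 "s t"] unfolding Ts_def s_def x_at[OF t] .
      show "(deriv (\<lambda>y. Tl y t) \<longlongrightarrow>
          b2 * exp (- (sqrt (\<alpha>\<^sub>s D / \<alpha>\<^sub>l D) * \<delta>)\<^sup>2) / sqrt (pi * \<alpha>\<^sub>l D * t)) (at_right (s t))"
        using deriv_lim[OF pos(2) t, of _ b2 "s t"] unfolding Tl_def s_def front[OF pos(2) t] .
      show "k\<^sub>s D * (b1 * exp (- \<delta>\<^sup>2) / sqrt (pi * \<alpha>\<^sub>s D * t)) -
          k\<^sub>l D * (b2 * exp (- (sqrt (\<alpha>\<^sub>s D / \<alpha>\<^sub>l D) * \<delta>)\<^sup>2) / sqrt (pi * \<alpha>\<^sub>l D * t)) =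
          \<gamma> D * \<rho> D * deriv s t"
        using heat_balance_iff[OF \<delta> t, of T] T(4) unfolding b DERIV_imp_deriv[OF s_deriv[OF t]] by blast
    qed
    show "\<exists>gs gl. (deriv (\<lambda>y. Cs y t) \<longlongrightarrow> gs) (at_left (s t)) \<and>
        (deriv (\<lambda>y. Cl y t) \<longlongrightarrow> gl) (at_right (s t)) \<and>
        d\<^sub>l D * gl - d\<^sub>s D * gs = (f\<^sub>s D T - f\<^sub>l D T) * deriv s t"
    proof (intro exI conjI)
      show "(deriv (\<lambda>y. Cs y t) \<longlongrightarrow> 0) (at_left (s t))"
        by (simp add: Cs_def similarity_profile_def)
      show "(deriv (\<lambda>y. Cl y t) \<longlongrightarrow>
          b4 * exp (- (sqrt (\<alpha>\<^sub>s D / d\<^sub>l D) * \<delta>)\<^sup>2) / sqrt (pi * d\<^sub>l D * t)) (at_right (s t))"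
        using deriv_lim[OF pos(4) t, of _ b4 "s t"] unfolding Cl_def s_def front[OF pos(4) t] .
      show "d\<^sub>l D * (b4 * exp (- (sqrt (\<alpha>\<^sub>s D / d\<^sub>l D) * \<delta>)\<^sup>2) / sqrt (pi * d\<^sub>l D * t)) - d\<^sub>s D * 0 =
          (f\<^sub>s D T - f\<^sub>l D T) * deriv s t"
        using solute_balance_iff[OF \<delta> t T(1,2)] T(3,5)
        unfolding b DERIV_imp_deriv[OF s_deriv[OF t]] by simp
    qed
  next
    fix x :: real assume "x > 0"
    then show "((\<lambda>t. Tl x t) \<longlongrightarrow> T\<^sub>0 D) (at 0 within {t. 0 < t \<and> s t < x})"
      "((\<lambda>t. Cl x t) \<longlongrightarrow> C\<^sub>0 D) (at 0 within {t. 0 < t \<and> s t < x})"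
      using similarity_profile_initial[OF pos(2), of x "{t. 0 < t \<and> s t < x}" "T\<^sub>0 D - b2" b2]
        similarity_profile_initial[OF pos(4), of x "{t. 0 < t \<and> s t < x}" "C\<^sub>0 D - b4" b4]
      by (auto simp: Tl_def Cl_def)
  qed (use T pos in \<open>auto simp: Ts_def Tl_def Cs_def Cl_def intro: solves_heat_at_similarity_profile\<close>)
  moreover have "similarity_form_on R \<kappa> (similarity_profile \<kappa> A B)" for R \<kappa> A B
    unfolding similarity_form_on_def similarity_profile_def by blast
  ultimately have "similarity_solution D h0 s T Ts Tl Cs Cl"
    by (simp add: similarity_solution_def Ts_def Tl_def Cs_def Cl_def)
  moreover have "Cs = (\<lambda>x t. f\<^sub>s D T)"
    by (simp add: Cs_def similarity_profile_def fun_eq_iff)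
  ultimately show ?thesis
    by (simp only: Ts_def Tl_def Cl_def b s_def solid_temperature_def liquid_temperature_def
        liquid_concentration_def)
qed

text \<open>The conditions at time $1$ suffice, except that the shape of the front needs all times and the
  bulk value of the liquid concentration comes from the initial condition.\<close>
lemma similarity_solution_determined:
  assumes sol: "similarity_solution D h0 s Tk Ts Tl Cs Cl"
  obtains \<delta> where "coupled_system D h0 \<delta> Tk" "\<And>t. 0 < t \<Longrightarrow> s t = 2 * \<delta> * sqrt (\<alpha>\<^sub>s D * t)"
    "\<And>x t. (x, t) \<in> solid_region s \<Longrightarrow> Ts x t = solid_temperature \<delta> Tk x t \<and> Cs x t = f\<^sub>s D Tk"
    "\<And>x t. (x, t) \<in> liquid_region s \<Longrightarrow>
       Tl x t = liquid_temperature \<delta> Tk x t \<and> Cl x t = liquid_concentration \<delta> Tk x t"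
proof -
  have P2: "solves_P2 D h0 s Tk Ts Tl Cs Cl"
    using sol by (simp add: similarity_solution_def)
  have form: "\<exists>A B. \<forall>x t. (x, t) \<in> R \<longrightarrow> u x t = similarity_profile \<kappa> A B x t"
    if "similarity_form_on R \<kappa> u" for R \<kappa> u
    using that unfolding similarity_form_on_def similarity_profile_def by fast
  obtain a1 b1 where Ts: "\<And>x t. (x, t) \<in> solid_region s \<Longrightarrow> Ts x t = similarity_profile (\<alpha>\<^sub>s D) a1 b1 x t"
    using form sol unfolding similarity_solution_def by metis
  obtain a2 b2 where Tl: "\<And>x t. (x, t) \<in> liquid_region s \<Longrightarrow> Tl x t = similarity_profile (\<alpha>\<^sub>l D) a2 b2 x t"
    using form sol unfolding similarity_solution_def by metis
  obtain a3 b3 where Cs: "\<And>x t. (x, t) \<in> solid_region s \<Longrightarrow> Cs x t = similarity_profile (d\<^sub>s D) a3 b3 x t"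
    using form sol unfolding similarity_solution_def by metis
  obtain a4 b4 where Cl: "\<And>x t. (x, t) \<in> liquid_region s \<Longrightarrow> Cl x t = similarity_profile (d\<^sub>l D) a4 b4 x t"
    using form sol unfolding similarity_solution_def by metis

  note Tk = solves_P2D(1,2)[OF P2]
  have s_pos: "0 < s t" if "t > 0" for t
    using solves_P2D(3)[OF P2] that by blast
  have solid: "Ts x t = similarity_profile (\<alpha>\<^sub>s D) a1 b1 x t"
    "Cs x t = similarity_profile (d\<^sub>s D) a3 b3 x t" if "t > 0" "0 < x" "x < s t" for x t
    using Ts Cs that by (auto simp: solid_region_def)
  have liquid: "Tl x t = similarity_profile (\<alpha>\<^sub>l D) a2 b2 x t"
    "Cl x t = similarity_profile (d\<^sub>l D) a4 b4 x t" if "t > 0" "s t < x" for x t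
    using Tl Cl that by (auto simp: liquid_region_def)

  note wall = limit_at_left_end[where a = 0 and b = "s t" for t]
  note solid_front = limit_at_right_end[where a = 0 and b = "s t" for t]
  \<comment> \<open>Any interval to the right of the front serves for limits at the front; length 1 is arbitrary.\<close>
  note liquid_front = limit_at_left_end[where a = "s t" and b = "s t + 1" for t]

  have Ts_front: "a1 + b1 * erf (s t / (2 * sqrt (\<alpha>\<^sub>s D * t))) = Tk" if "t > 0" for t
  proof -
    have "((\<lambda>x. Ts x t) \<longlongrightarrow> Tk) (at_left (s t))"
      using solves_P2D(5)[OF P2] that by blast
    from solid_front(1)[OF pos(1) that s_pos[OF that] solid(1)[OF that] this]
    show ?thesis by (simp add: similarity_profile_def)
  qed
  have Tl_front: "a2 + b2 * erf (s t / (2 * sqrt (\<alpha>\<^sub>l D * t))) = Tk" if "t > 0" for t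
  proof -
    have "((\<lambda>x. Tl x t) \<longlongrightarrow> Tk) (at_right (s t))"
      using solves_P2D(5)[OF P2] that by blast
    from liquid_front(1)[OF pos(2) that _ liquid(1)[OF that] this]
    show ?thesis by (simp add: similarity_profile_def)
  qed
  have Cl_front: "a4 + b4 * erf (s t / (2 * sqrt (d\<^sub>l D * t))) = f\<^sub>l D Tk" if "t > 0" for t
  proof -
    have "((\<lambda>x. Cl x t) \<longlongrightarrow> f\<^sub>l D Tk) (at_right (s t))"
      using solves_P2D(10)[OF P2] that by blast
    from liquid_front(1)[OF pos(4) that _ liquid(2)[OF that] this]
    show ?thesis by (simp add: similarity_profile_def)
  qed
  have b3: "b3 = 0"
  proof -
    have "((\<lambda>x. deriv (\<lambda>y. Cs y 1) x) \<longlongrightarrow> 0) (at_right 0)"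
      using solves_P2D(7)[OF P2] zero_less_one by blast
    from wall(2)[OF pos(3) zero_less_one s_pos[OF zero_less_one] solid(2)[OF zero_less_one] this] show ?thesis
      using pos by simp
  qed
  have a3: "a3 = f\<^sub>s D Tk"
  proof -
    have "((\<lambda>x. Cs x 1) \<longlongrightarrow> f\<^sub>s D Tk) (at_left (s 1))"
      using solves_P2D(8)[OF P2] zero_less_one by blast
    from solid_front(1)[OF pos(3) zero_less_one s_pos[OF zero_less_one] solid(2)[OF zero_less_one] this] show ?thesis
      using b3 by (simp add: similarity_profile_def)
  qed
  have convective: "k\<^sub>s D * b1 = h0 * sqrt (pi * \<alpha>\<^sub>s D) * (a1 - T_inf D)"
  proof -
    obtain v g where vg: "((\<lambda>x. Ts x 1) \<longlongrightarrow> v) (at_right 0)"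
      "((\<lambda>x. deriv (\<lambda>y. Ts y 1) x) \<longlongrightarrow> g) (at_right 0)" "k\<^sub>s D * g = h0 / sqrt 1 * (v - T_inf D)"
      using solves_P2D(4)[OF P2] zero_less_one by blast
    have "v = a1" "g = b1 / sqrt (pi * \<alpha>\<^sub>s D)"
      using wall(1)[OF pos(1) zero_less_one s_pos[OF zero_less_one] solid(1)[OF zero_less_one] vg(1)]
        wall(2)[OF pos(1) zero_less_one s_pos[OF zero_less_one] solid(1)[OF zero_less_one] vg(2)]
      by (simp_all add: similarity_profile_def)
    with vg(3) show ?thesis
      using pos by (simp add: field_simps)
  qed
  have Tl_inf: "a2 + b2 = T\<^sub>0 D"
  proof (rule tendsto_unique[OF trivial_limit_at_top_linorder similarity_profile_at_infinity[OF pos(2) zero_less_one]])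
    have "((\<lambda>x. Tl x 1) \<longlongrightarrow> T\<^sub>0 D) at_top"
      using solves_P2D(6)[OF P2] zero_less_one by blast
    then show "((\<lambda>x. similarity_profile (\<alpha>\<^sub>l D) a2 b2 x 1) \<longlongrightarrow> T\<^sub>0 D) at_top"
      by (rule Lim_transform_eventually)
        (rule eventually_mono[OF eventually_gt_at_top[of "s 1"] liquid(1)[OF zero_less_one]])
  qed

  define \<delta> where "\<delta> = s 1 / (2 * sqrt (\<alpha>\<^sub>s D))"
  have \<delta>: "\<delta> > 0"
    using s_pos[of 1] pos by (simp add: \<delta>_def)
  have s: "s t = 2 * \<delta> * sqrt (\<alpha>\<^sub>s D * t)" if t: "t > 0" for t
  proof -
    have "?thesis" if "\<kappa> > 0" "s t / (2 * sqrt (\<kappa> * t)) = s 1 / (2 * sqrt (\<kappa> * 1))" for \<kappa>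
    proof -
      have "s t = s t / (2 * sqrt (\<kappa> * t)) * (2 * sqrt (\<kappa> * t))"
        using that(1) t by simp
      also have "\<dots> = s 1 * sqrt t"
        unfolding that(2) using that(1) by (simp add: real_sqrt_mult)
      also have "\<dots> = 2 * \<delta> * sqrt (\<alpha>\<^sub>s D * t)"
        using pos by (simp add: \<delta>_def real_sqrt_mult)
      finally show ?thesis .
    qed
    \<comment> \<open>One of the two temperatures is not constant, and since \<open>erf\<close> is injective the similarity
      variable of that temperature is constant along the front.\<close>
    moreover have "\<exists>\<kappa>>0. s t / (2 * sqrt (\<kappa> * t)) = s 1 / (2 * sqrt (\<kappa> * 1))"
    proof (cases "b1 = 0")
      case False
      have "b1 * erf (s t / (2 * sqrt (\<alpha>\<^sub>s D * t))) = b1 * erf (s 1 / (2 * sqrt (\<alpha>\<^sub>s D * 1)))"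
        using Ts_front[OF t] Ts_front[OF zero_less_one] by linarith
      with False pos(1) show ?thesis by auto
    next
      case True
      then have "Tk = T_inf D"
        using convective h0_pos pos Ts_front[of 1] by simp
      then have "b2 \<noteq> 0"
        using Tl_front[of 1] Tl_inf temperature_order by auto
      have "b2 * erf (s t / (2 * sqrt (\<alpha>\<^sub>l D * t))) = b2 * erf (s 1 / (2 * sqrt (\<alpha>\<^sub>l D * 1)))"
        using Tl_front[OF t] Tl_front[OF zero_less_one] by linarith
      with \<open>b2 \<noteq> 0\<close> pos(2) show ?thesis by auto
    qed
    ultimately show ?thesis by blast
  qed
  note front = similarity_variable_at_front[OF pos(1)]
  have x_at: "s 1 / (2 * sqrt (\<alpha>\<^sub>s D * 1)) = \<delta>" "s 1 / (2 * sqrt (\<alpha>\<^sub>l D * 1)) = sqrt (\<alpha>\<^sub>s D / \<alpha>\<^sub>l D) * \<delta>"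
    "s 1 / (2 * sqrt (d\<^sub>l D * 1)) = sqrt (\<alpha>\<^sub>s D / d\<^sub>l D) * \<delta>"
    using s[OF zero_less_one] front[OF pos(1) zero_less_one, of \<delta>] front[OF pos(2) zero_less_one, of \<delta>]
      front[OF pos(4) zero_less_one, of \<delta>] pos by simp_all

  have Cl_init: "a4 + b4 = C\<^sub>0 D"
  proof -
    \<comment> \<open>The initial value is a limit along the times at which the point 1 is liquid. The front passes it
      at time \<open>\<epsilon>\<close>, so these times accumulate at 0 and the limit is informative.\<close>
    define \<epsilon> where "\<epsilon> = 1 / (4 * \<delta>\<^sup>2 * \<alpha>\<^sub>s D)"
    have "\<epsilon> > 0" using \<delta> pos by (simp add: \<epsilon>_def)
    have small: "s t < 1" if "0 < t" "t < \<epsilon>" for t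
    proof -
      have "(s t)\<^sup>2 = 4 * \<delta>\<^sup>2 * \<alpha>\<^sub>s D * t"
        using s[OF that(1)] that(1) pos by (simp add: power_mult_distrib)
      also have "\<dots> < 1\<^sup>2"
        using that(2) \<delta> pos by (simp add: \<epsilon>_def field_simps)
      finally show ?thesis
        by (rule power_less_imp_less_base) simp
    qed
    have "((\<lambda>t. Cl 1 t) \<longlongrightarrow> C\<^sub>0 D) (at 0 within {t. 0 < t \<and> s t < 1})"
      using solves_P2D(9)[OF P2] zero_less_one by blast
    then have "((\<lambda>t. Cl 1 t) \<longlongrightarrow> C\<^sub>0 D) (at 0 within {0<..<\<epsilon>})"
      by (rule tendsto_within_subset) (auto simp: small)
    moreover have "\<forall>\<^sub>F t in at 0 within {0<..<\<epsilon>}. Cl 1 t = similarity_profile (d\<^sub>l D) a4 b4 1 t"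
      unfolding eventually_at_filter by (intro always_eventually) (auto simp: small liquid)
    ultimately have "((\<lambda>t. similarity_profile (d\<^sub>l D) a4 b4 1 t) \<longlongrightarrow> C\<^sub>0 D) (at 0 within {0<..<\<epsilon>})"
      by (rule Lim_transform_eventually)
    moreover have "((\<lambda>t. similarity_profile (d\<^sub>l D) a4 b4 1 t) \<longlongrightarrow> a4 + b4) (at 0 within {0<..<\<epsilon>})"
      by (rule similarity_profile_initial[OF pos(4)]) auto
    moreover have "at 0 within {0<..<\<epsilon>} \<noteq> bot"
      using \<open>\<epsilon> > 0\<close> by (simp add: at_within_eq_bot_iff)
    ultimately show ?thesis
      using tendsto_unique by blast
  qed

  have s_deriv: "deriv s 1 = \<delta> * sqrt (\<alpha>\<^sub>s D) / sqrt 1"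
  proof -
    have "deriv s 1 = deriv (\<lambda>t. 2 * \<delta> * sqrt (\<alpha>\<^sub>s D * t)) 1"
      by (rule deriv_cong_open[of "{0<..}"]) (auto simp: s)
    then show ?thesis
      using DERIV_imp_deriv[OF DERIV_parabolic_front[OF pos(1) zero_less_one]] by simp
  qed

  have front_values: "a1 + b1 * erf \<delta> = Tk" "a2 + b2 * erf (sqrt (\<alpha>\<^sub>s D / \<alpha>\<^sub>l D) * \<delta>) = Tk"
    "a4 + b4 * erf (sqrt (\<alpha>\<^sub>s D / d\<^sub>l D) * \<delta>) = f\<^sub>l D Tk"
    using Ts_front[OF zero_less_one] Tl_front[OF zero_less_one] Cl_front[OF zero_less_one]
    unfolding x_at by blast+
  have b1: "b1 = solid_heat_coeff \<delta> Tk"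
  proof -
    have "b1 * (k\<^sub>s D + h0 * sqrt (pi * \<alpha>\<^sub>s D) * erf \<delta>) = h0 * sqrt (pi * \<alpha>\<^sub>s D) * (Tk - T_inf D)"
      unfolding front_values(1)[symmetric] using convective by (simp only: ring_distribs) algebra
    then show ?thesis
      unfolding solid_heat_coeff_def using solid_resistance_pos[of \<delta>] \<delta> by (subst eq_divide_eq) simp
  qed
  have a1: "a1 = Tk - solid_heat_coeff \<delta> Tk * erf \<delta>"
    using front_values(1) b1 by simp
  have b2: "b2 = liquid_heat_coeff \<delta> Tk"
    unfolding liquid_heat_coeff_def front_values(2)[symmetric] Tl_inf[symmetric]
    by (subst nonzero_eq_divide_eq[OF erfc_nonzero]) (simp add: erfc_def algebra_simps)
  have a2: "a2 = T\<^sub>0 D - liquid_heat_coeff \<delta> Tk"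
    using Tl_inf b2 by simp
  have b4: "b4 = liquid_solute_coeff \<delta> Tk"
    unfolding liquid_solute_coeff_def front_values(3)[symmetric] Cl_init[symmetric]
    by (subst nonzero_eq_divide_eq[OF erfc_nonzero]) (simp add: erfc_def algebra_simps)
  have a4: "a4 = C\<^sub>0 D - liquid_solute_coeff \<delta> Tk"
    using Cl_init b4 by simp

  have "Tk = W D h0 \<delta>"
  proof -
    obtain gs gl where g: "((\<lambda>x. deriv (\<lambda>y. Ts y 1) x) \<longlongrightarrow> gs) (at_left (s 1))"
      "((\<lambda>x. deriv (\<lambda>y. Tl y 1) x) \<longlongrightarrow> gl) (at_right (s 1))"
      "k\<^sub>s D * gs - k\<^sub>l D * gl = \<gamma> D * \<rho> D * deriv s 1"
      using solves_P2D(11)[OF P2] zero_less_one by blast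
    have "gs = b1 * exp (- \<delta>\<^sup>2) / sqrt (pi * \<alpha>\<^sub>s D * 1)"
      using solid_front(2)[OF pos(1) zero_less_one s_pos[OF zero_less_one] solid(1)[OF zero_less_one] g(1)] unfolding x_at by simp
    moreover have "gl = b2 * exp (- (sqrt (\<alpha>\<^sub>s D / \<alpha>\<^sub>l D) * \<delta>)\<^sup>2) / sqrt (pi * \<alpha>\<^sub>l D * 1)"
      using liquid_front(2)[OF pos(2) zero_less_one _ liquid(1)[OF zero_less_one] g(2)] unfolding x_at by simp
    ultimately show ?thesis
      using heat_balance_iff[OF \<delta> zero_less_one, of Tk] g(3) unfolding s_deriv b1 b2 by blast
  qed
  moreover have "Tk \<noteq> T\<^sub>0\<^sub>l D \<and> M D \<delta> = \<phi> D Tk"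
  proof -
    obtain gs gl where g: "((\<lambda>x. deriv (\<lambda>y. Cs y 1) x) \<longlongrightarrow> gs) (at_left (s 1))"
      "((\<lambda>x. deriv (\<lambda>y. Cl y 1) x) \<longlongrightarrow> gl) (at_right (s 1))"
      "d\<^sub>l D * gl - d\<^sub>s D * gs = (f\<^sub>s D Tk - f\<^sub>l D Tk) * deriv s 1"
      using solves_P2D(12)[OF P2] zero_less_one by blast
    have "gs = 0"
      using solid_front(2)[OF pos(3) zero_less_one s_pos[OF zero_less_one] solid(2)[OF zero_less_one] g(1)] b3 by simp
    moreover have "gl = b4 * exp (- (sqrt (\<alpha>\<^sub>s D / d\<^sub>l D) * \<delta>)\<^sup>2) / sqrt (pi * d\<^sub>l D * 1)"
      using liquid_front(2)[OF pos(4) zero_less_one _ liquid(2)[OF zero_less_one] g(2)] unfolding x_at by simp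
    ultimately show ?thesis
      using solute_balance_iff[OF \<delta> zero_less_one Tk] g(3) unfolding s_deriv b4 by simp
  qed
  ultimately have "coupled_system D h0 \<delta> Tk"
    using \<delta> Tk by (simp add: coupled_system_def)
  moreover have "Ts x t = solid_temperature \<delta> Tk x t \<and> Cs x t = f\<^sub>s D Tk" if "(x, t) \<in> solid_region s" for x t
    using Ts[OF that] Cs[OF that]
    by (simp add: solid_temperature_def a1 b1 a3 b3) (simp add: similarity_profile_def)
  moreover have "Tl x t = liquid_temperature \<delta> Tk x t \<and> Cl x t = liquid_concentration \<delta> Tk x t"
    if "(x, t) \<in> liquid_region s" for x t
    using Tl[OF that] Cl[OF that]
    by (simp add: liquid_temperature_def liquid_concentration_def a2 b2 a4 b4)
  ultimately show thesis
    using that s by blast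
qed

end

theorem theorem4p1:
  fixes D :: alloy_data and h0 :: real
  assumes "alloy D"
    and "h0 > 0"
    and "(T\<^sub>0 D - T\<^sub>0\<^sub>l D) * k\<^sub>l D / ((T\<^sub>0\<^sub>l D - T_inf D) * sqrt (pi * \<alpha>\<^sub>l D)) < h0"
    and "h0 < (T\<^sub>0 D - T\<^sub>0\<^sub>s D) * k\<^sub>l D / ((T\<^sub>0\<^sub>s D - T_inf D) * sqrt (pi * \<alpha>\<^sub>l D))"
  shows "\<exists>\<delta> Tk.
    coupled_system D h0 \<delta> Tk \<and>
    (\<forall>\<delta>' Tk'. coupled_system D h0 \<delta>' Tk' \<longrightarrow> \<delta>' = \<delta> \<and> Tk' = Tk) \<and>
    (let s = (\<lambda>t. 2 * \<delta> * sqrt (\<alpha>\<^sub>s D * t));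
         Ts = (\<lambda>x t. Tk + h0 * sqrt (pi * \<alpha>\<^sub>s D) * (Tk - T_inf D) /
                 (k\<^sub>s D + h0 * sqrt (pi * \<alpha>\<^sub>s D) * erf \<delta>) *
                 (erf (x / (2 * sqrt (\<alpha>\<^sub>s D * t))) - erf \<delta>));
         Tl = (\<lambda>x t. T\<^sub>0 D + (Tk - T\<^sub>0 D) / erfc (sqrt (\<alpha>\<^sub>s D / \<alpha>\<^sub>l D) * \<delta>) *
                 erfc (x / (2 * sqrt (\<alpha>\<^sub>l D * t))));
         Cs = (\<lambda>x t. f\<^sub>s D Tk);
         Cl = (\<lambda>x t. C\<^sub>0 D + (f\<^sub>l D Tk - C\<^sub>0 D) / erfc (sqrt (\<alpha>\<^sub>s D / d\<^sub>l D) * \<delta>) *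
                 erfc (x / (2 * sqrt (d\<^sub>l D * t))))
     in similarity_solution D h0 s Tk Ts Tl Cs Cl \<and>
        (\<forall>s' Tk' Ts' Tl' Cs' Cl'. similarity_solution D h0 s' Tk' Ts' Tl' Cs' Cl' \<longrightarrow>
           Tk' = Tk \<and> (\<forall>t>0. s' t = s t) \<and>
           (\<forall>(x, t) \<in> solid_region s. Ts' x t = Ts x t \<and> Cs' x t = Cs x t) \<and>
           (\<forall>(x, t) \<in> liquid_region s. Tl' x t = Tl x t \<and> Cl' x t = Cl x t)))"
proof -
  interpret convective_alloy D h0
    using assms by (simp add: convective_alloy_def convective_alloy_axioms_def)
  obtain \<delta> T where coupled: "coupled_system D h0 \<delta> T"
    using coupled_system_exists by blast
  have signs: "(T - T\<^sub>0 D) / erfc (sqrt (\<alpha>\<^sub>s D / \<alpha>\<^sub>l D) * \<delta>) = - liquid_heat_coeff \<delta> T"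
    "(f\<^sub>l D T - C\<^sub>0 D) / erfc (sqrt (\<alpha>\<^sub>s D / d\<^sub>l D) * \<delta>) = - liquid_solute_coeff \<delta> T"
    by (simp_all add: liquid_heat_coeff_def liquid_solute_coeff_def minus_divide_left)
  have Ts: "T + h0 * sqrt (pi * \<alpha>\<^sub>s D) * (T - T_inf D) /
      (k\<^sub>s D + h0 * sqrt (pi * \<alpha>\<^sub>s D) * erf \<delta>) *
      (erf (x / (2 * sqrt (\<alpha>\<^sub>s D * t))) - erf \<delta>) = solid_temperature \<delta> T x t" for x t
    unfolding solid_heat_coeff_def[symmetric]
    by (simp add: solid_temperature_def similarity_profile_def algebra_simps)
  have Tl: "T\<^sub>0 D + (T - T\<^sub>0 D) / erfc (sqrt (\<alpha>\<^sub>s D / \<alpha>\<^sub>l D) * \<delta>) *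
      erfc (x / (2 * sqrt (\<alpha>\<^sub>l D * t))) = liquid_temperature \<delta> T x t" for x t
    unfolding signs
    by (simp add: liquid_temperature_def similarity_profile_def erfc_def algebra_simps)
  have Cl: "C\<^sub>0 D + (f\<^sub>l D T - C\<^sub>0 D) / erfc (sqrt (\<alpha>\<^sub>s D / d\<^sub>l D) * \<delta>) *
      erfc (x / (2 * sqrt (d\<^sub>l D * t))) = liquid_concentration \<delta> T x t" for x t
    unfolding signs
    by (simp add: liquid_concentration_def similarity_profile_def erfc_def algebra_simps)
  have unique: "T' = T \<and> (\<forall>t>0. s' t = 2 * \<delta> * sqrt (\<alpha>\<^sub>s D * t)) \<and>
      (\<forall>(x, t) \<in> solid_region (\<lambda>t. 2 * \<delta> * sqrt (\<alpha>\<^sub>s D * t)).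
         Ts' x t = solid_temperature \<delta> T x t \<and> Cs' x t = f\<^sub>s D T) \<and>
      (\<forall>(x, t) \<in> liquid_region (\<lambda>t. 2 * \<delta> * sqrt (\<alpha>\<^sub>s D * t)).
         Tl' x t = liquid_temperature \<delta> T x t \<and> Cl' x t = liquid_concentration \<delta> T x t)"
    if sol: "similarity_solution D h0 s' T' Ts' Tl' Cs' Cl'" for s' T' Ts' Tl' Cs' Cl'
  proof -
    obtain \<delta>' where \<delta>': "coupled_system D h0 \<delta>' T'"
      "\<And>t. 0 < t \<Longrightarrow> s' t = 2 * \<delta>' * sqrt (\<alpha>\<^sub>s D * t)"
      "\<And>x t. (x, t) \<in> solid_region s' \<Longrightarrow> Ts' x t = solid_temperature \<delta>' T' x t \<and> Cs' x t = f\<^sub>s D T'"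
      "\<And>x t. (x, t) \<in> liquid_region s' \<Longrightarrow>
         Tl' x t = liquid_temperature \<delta>' T' x t \<and> Cl' x t = liquid_concentration \<delta>' T' x t"
      using similarity_solution_determined[OF sol] by metis
    have eq: "\<delta>' = \<delta>" "T' = T"
      using coupled_system_unique[OF coupled \<delta>'(1)] by simp_all
    have "solid_region (\<lambda>t. 2 * \<delta> * sqrt (\<alpha>\<^sub>s D * t)) = solid_region s'"
      "liquid_region (\<lambda>t. 2 * \<delta> * sqrt (\<alpha>\<^sub>s D * t)) = liquid_region s'"
      using \<delta>'(2) eq by (auto simp: solid_region_def liquid_region_def)
    then show ?thesis
      using \<delta>'(2-) eq by auto
  qed
  show ?thesis
    unfolding Let_def
    by (rule exI[of _ \<delta>], rule exI[of _ T], unfold Ts Tl Cl, intro conjI allI impI)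
      (use coupled coupled_system_unique[OF coupled] unique
        similarity_solution_of_coupled_system[OF coupled] in blast)+
qed

end
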